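(* Consider the accelerated sticky particle dynamics (see context) with initial mass distribution $P_0$ of total mass $1$, initial velocity function $u_0$ and non-increasing initial acceleration function $\gamma_0$. Let $X_0$ have law $P_0$, $X_t=\phi(X_0,t)$, let $V_t=u(X_t,t)$ be the velocity process and $\Gamma_t$ its right-hand derivative, and let $\mu(\cdot,t)=\mathrm{Law}(V_t)$, $\mu_0=\mathrm{Law}(V_0)$, $w(x,t)=\mathbb{E}[\Gamma_0|V_t=x]$, $w_0(x)=\mathbb{E}[\Gamma_0|V_0=x]$, $a(x,t)=\mathrm{Var}[\Gamma_t|V_t=x]$. Then $$\begin{cases}\partial_t(\mu)+\partial_x(w\mu)=\Delta(\mu)\\ \partial_t(w\mu)+\partial_x((w^2+a)\mu)=\Delta(w\mu)\\ \mu|_{t=0}=\mu_0,\quad w\mu|_{t=0}=w_0\mu_0,\quad a\mu|_{t=0}=0\\ \Delta(\mu)|_{t=0}=0,\quad\Delta(w\mu)|_{t=0}=0\end{cases}$$ in the following weak sense. The fields $\mu$ and $w\mu$ are weakly càdlàg in $t>0$, and for all $f\in C^1_0(\mathbb{R})$ and $0<t_1<t_2$: $$\int f\,d\mu(\cdot,t_2)-\int f\,d\mu(\cdot,t_1)=\int_{t_1}^{t_2}\!\!\int f'(x)w(x,t)\,\mu(dx,t)\,dt+\int_{]t_1,t_2]}\!\int f(x)\,\Delta(\mu)(dx,dt),$$ $$\int f(x)w(x,t_2)\,\mu(dx,t_2)-\int f(x)w(x,t_1)\,\mu(dx,t_1)=\int_{t_1}^{t_2}\!\!\int f'(x)\left[w^2(x,t)+a(x,t)\right]\mu(dx,t)\,dt+\int_{]t_1,t_2]}\!\int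 f(x)\,\Delta(w\mu)(dx,dt).$$ Moreover, for every continuous compactly supported $g$, as $t\to0^+$: $\int g\,d\mu(\cdot,t)\to\int g\,d\mu_0$; $\int g(x)w(x,t)\,\mu(dx,t)\to\int g\,w_0\,d\mu_0$; $\int g(x)a(x,t)\,\mu(dx,t)\to0$; $\int g\,d[\mu(\cdot,t^+)-\mu(\cdot,t^-)]\to0$; and $\int g\,d[(w\mu)(\cdot,t^+)-(w\mu)(\cdot,t^-)]\to0$.
   Context: Accelerated sticky particle dynamics. There are $N$ particles with initial positions $x_1<\cdots<x_N$ in $\mathbb{R}$, masses $m_j>0$, initial velocities $v_j\in\mathbb{R}$ and initial accelerations $\theta_j\in\mathbb{R}$. Put $P_0=\sum_j m_j\delta_{x_j}$, $u_0(x_j)=v_j$, $\gamma_0(x_j)=\theta_j$. Each particle moves with constant acceleration until it collides; colliding particles stick together, with conservation of mass, momentum and force. Explicitly: for a nonempty set $G\subset\{x_1,\dots,x_N\}$ put $$c_G(t)=\frac{\sum_{x_j\in G}m_j\left(x_j+tv_j+\frac{t^2}{2}\theta_j\right)}{\sum_{x_j\in G}m_j}.$$ At time $0$ the partition $\xi_0$ of $\{x_1,\dots,x_N\}$ consists of the singletons. Let $s_0=0$. Given the partition $\xi_{s_k}$ at time $s_k$, the next shock time $s_{k+1}$ is the infimum of the times $t>s_k$ at which two distinct elements $G\ne G'$ of $\xi_{s_k}$ satisfy $c_G(t)=c_{G'}(t)$ ($s_{k+1}=+\infty$ if there is none). For $t\in[s_k,s_{k+1})$, $\xi_t=\xi_{s_k}$.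 At time $s_{k+1}$ all elements of $\xi_{s_k}$ having the same position $c_G(s_{k+1})$ are merged into one, which gives $\xi_{s_{k+1}}$. There are at most $N-1$ shock times. The elements of $\xi_t$ are called the clusters at time $t$. Flow. For $x_i$ in the cluster $G\in\xi_t$, set $$\phi(x_i,t)=c_G(t),\quad v(x_i,t)=\frac{\int_G\left(u_0(\eta)+t\gamma_0(\eta)\right)dP_0(\eta)}{P_0(G)},\quad \theta(x_i,t)=\frac{\int_G\gamma_0(\eta)\,dP_0(\eta)}{P_0(G)}.$$ Since distinct clusters at time $t$ have distinct positions, there are functions $u,\gamma$ with $v(x_i,t)=u(\phi(x_i,t),t)$ and $\theta(x_i,t)=\gamma(\phi(x_i,t),t)$. Thus $V_t=u(X_t,t)=v(X_0,t)$, and the right-hand derivative of $V$ is $\Gamma_t=\gamma(X_t,t)=\theta(X_0,t)$; in particular $\Gamma_0=\gamma_0(X_0)$. Conditional variance: $\mathrm{Var}[\Gamma_t|V_t=x]=\mathbb{E}[\Gamma_t^2|V_t=x]-(\mathbb{E}[\Gamma_t|V_t=x])^2$. Measure fields. $C^1_0(\mathbb{R})$ is the space of real $C^1$ functions with compact support. For a field $m=(m(\cdot,t))_{t>0}$ of measures on $\mathbb{R}$, $m(\cdot,t^+)$ and $m(\cdot,t^-)$ denote the weak limits (if they exist) of $m(\cdot,s)$ as $s\to t$ with $s>t$, resp. $s<t$; $m$ is (weakly) càdlàg if these limits exist for every $t>0$ and $m(\cdot,t^+)=m(\cdot,t)$. For a càdlàg field $m$, the jump measure on $\mathbb{R}\times(0,\infty)$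 is $\Delta(m)=\sum_{t>0}\left(m(\cdot,t^+)-m(\cdot,t^-)\right)\otimes\delta_t$, so that $\int_{]t_1,t_2]}\int f(x)\,\Delta(m)(dx,dt)=\sum_{t_1<t\le t_2}\int f(x)\,[m(dx,t^+)-m(dx,t^-)]$. The field $w\mu$ is the field of measures $w(x,t)\,\mu(dx,t)$. *)

theory Defs
  imports "HOL-Probability.Probability"
begin

section \<open>Accelerated sticky particle dynamics\<close>

text \<open>
  Particles are numbered \<open>1, \<dots>, N\<close>. Initial velocities and accelerations are given as functions
  of the initial position, that is \<open>v\<^sub>j = u0 (x\<^sub>j)\<close> and \<open>\<theta>\<^sub>j = \<gamma>0 (x\<^sub>j)\<close>; only their values at the
  points \<open>x\<^sub>j\<close> matter.
\<close>

record particles =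
  num :: nat
  pos :: "nat \<Rightarrow> real"
  mass :: "nat \<Rightarrow> real"
  u0 :: "real \<Rightarrow> real"
  \<gamma>0 :: "real \<Rightarrow> real"

definition particle_system :: "particles \<Rightarrow> bool" where
  "particle_system D \<longleftrightarrow>
     strict_mono_on {1..num D} (pos D) \<and> (\<forall>j\<in>{1..num D}. mass D j > 0)"

definition support :: "particles \<Rightarrow> real set" where
  "support D = pos D ` {1..num D}"

text \<open>\<open>P\<^sub>0 = \<Sum>\<^sub>j m\<^sub>j \<delta>\<^bsub>x\<^sub>j\<^esub>\<close>, obtained as the image under \<open>j \<mapsto> x\<^sub>j\<close> of the measure on
  \<open>{1, \<dots>, N}\<close> with weights \<open>m\<^sub>j\<close>.\<close>

definition P0 :: "particles \<Rightarrow> real measure" where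
  "P0 D = distr (point_measure {1..num D} (\<lambda>j. ennreal (mass D j))) borel (pos D)"

definition centre :: "particles \<Rightarrow> real set \<Rightarrow> real \<Rightarrow> real" where
  "centre D G t =
     (\<Sum>j | j \<in> {1..num D} \<and> pos D j \<in> G.
        mass D j * (pos D j + t * u0 D (pos D j) + t\<^sup>2 / 2 * \<gamma>0 D (pos D j))) /
     (\<Sum>j | j \<in> {1..num D} \<and> pos D j \<in> G. mass D j)"

text \<open>The infimum is taken in the extended reals, so it is \<open>\<infinity>\<close> if there is no further shock.\<close>

definition next_shock :: "particles \<Rightarrow> real set set \<Rightarrow> ereal \<Rightarrow> ereal" where
  "next_shock D \<xi> s =
     (INF t \<in> {t. ereal t > s \<and> (\<exists>G\<in>\<xi>. \<exists>G'\<in>\<xi>. G \<noteq> G' \<and> centre D G t = centre D G' t)}. ereal t)"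

definition merge :: "particles \<Rightarrow> real set set \<Rightarrow> real \<Rightarrow> real set set" where
  "merge D \<xi> t = (\<lambda>G. \<Union>{G'\<in>\<xi>. centre D G' t = centre D G t}) ` \<xi>"

text \<open>\<open>stage D k\<close> is the pair of the shock time \<open>s\<^sub>k\<close> and the partition at that time. Once
  \<open>s\<^sub>k = \<infinity>\<close> the sequence is stationary.\<close>

primrec stage :: "particles \<Rightarrow> nat \<Rightarrow> ereal \<times> real set set" where
  "stage D 0 = (0, (\<lambda>y. {y}) ` support D)"
| "stage D (Suc k) =
     (let s = fst (stage D k); \<xi> = snd (stage D k); s' = next_shock D \<xi> s
      in (s', if s' = \<infinity> then \<xi> else merge D \<xi> (real_of_ereal s')))"

definition clusters :: "particles \<Rightarrow> real \<Rightarrow> real set set" where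
  "clusters D t =
     snd (stage D (THE k. fst (stage D k) \<le> ereal t \<and> ereal t < fst (stage D (Suc k))))"

text \<open>The cluster containing \<open>y\<close>, for \<open>y\<close> in the support; it is empty for all other \<open>y\<close>.\<close>

definition cluster_of :: "particles \<Rightarrow> real \<Rightarrow> real \<Rightarrow> real set" where
  "cluster_of D y t = \<Union>{G \<in> clusters D t. y \<in> G}"

definition \<phi> :: "particles \<Rightarrow> real \<Rightarrow> real \<Rightarrow> real" where
  "\<phi> D y t = centre D (cluster_of D y t) t"

definition vel :: "particles \<Rightarrow> real \<Rightarrow> real \<Rightarrow> real" where
  "vel D y t =
     (LINT \<eta>:cluster_of D y t|P0 D. u0 D \<eta> + t * \<gamma>0 D \<eta>) / measure (P0 D) (cluster_of D y t)"

text \<open>The velocity as a function of the current position \<open>z\<close>: the function \<open>u\<close> with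
  \<open>vel (x\<^sub>i, t) = u (\<phi> (x\<^sub>i, t), t)\<close>.\<close>

definition u :: "particles \<Rightarrow> real \<Rightarrow> real \<Rightarrow> real" where
  "u D z t = (THE r. \<exists>y\<in>support D. \<phi> D y t = z \<and> vel D y t = r)"


section \<open>The processes\<close>

definition X :: "particles \<Rightarrow> ('a \<Rightarrow> real) \<Rightarrow> real \<Rightarrow> 'a \<Rightarrow> real" where
  "X D X0 t \<omega> = \<phi> D (X0 \<omega>) t"

definition V :: "particles \<Rightarrow> ('a \<Rightarrow> real) \<Rightarrow> real \<Rightarrow> 'a \<Rightarrow> real" where
  "V D X0 t \<omega> = u D (X D X0 t \<omega>) t"

text \<open>The right-hand derivative of the velocity process.\<close>

definition \<Gamma> :: "particles \<Rightarrow> ('a \<Rightarrow> real) \<Rightarrow> real \<Rightarrow> 'a \<Rightarrow> real" where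
  "\<Gamma> D X0 t \<omega> = vector_derivative (\<lambda>s. V D X0 s \<omega>) (at_right t)"


section \<open>Conditioning on the value of a random variable\<close>

text \<open>\<open>g\<close> is a version of \<open>x \<mapsto> E[Z | Y = x]\<close>, that is, \<open>g (Y)\<close> is a version of the conditional
  expectation of \<open>Z\<close> given the sigma-algebra generated by \<open>Y\<close>.\<close>

definition is_cond_exp_at :: "'a measure \<Rightarrow> ('a \<Rightarrow> real) \<Rightarrow> ('a \<Rightarrow> real) \<Rightarrow> (real \<Rightarrow> real) \<Rightarrow> bool" where
  "is_cond_exp_at M Z Y g \<longleftrightarrow>
     g \<in> borel_measurable borel \<and>
     (AE \<omega> in M. g (Y \<omega>) = real_cond_exp M (vimage_algebra (space M) Y borel) Z \<omega>)"

definition is_cond_var_at :: "'a measure \<Rightarrow> ('a \<Rightarrow> real) \<Rightarrow> ('a \<Rightarrow> real) \<Rightarrow> (real \<Rightarrow> real) \<Rightarrow> bool" where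
  "is_cond_var_at M Z Y a \<longleftrightarrow>
     (\<exists>g h. is_cond_exp_at M Z Y g \<and> is_cond_exp_at M (\<lambda>\<omega>. (Z \<omega>)\<^sup>2) Y h \<and>
            a = (\<lambda>x. h x - (g x)\<^sup>2))"


section \<open>Fields of signed measures\<close>

text \<open>
  A finite signed measure on the line is represented by a pair \<open>(\<nu>\<^sub>1, \<nu>\<^sub>2)\<close> of finite Borel measures,
  standing for \<open>\<nu>\<^sub>1 - \<nu>\<^sub>2\<close>. The representation is not unique, so signed measures are only compared
  through their integrals.
\<close>

type_synonym signed_measure = "real measure \<times> real measure"

definition finite_signed :: "signed_measure \<Rightarrow> bool" where
  "finite_signed \<nu> \<longleftrightarrow>
     finite_measure (fst \<nu>) \<and> sets (fst \<nu>) = sets borel \<and>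
     finite_measure (snd \<nu>) \<and> sets (snd \<nu>) = sets borel"

definition sint :: "signed_measure \<Rightarrow> (real \<Rightarrow> real) \<Rightarrow> real" where
  "sint \<nu> f = (\<integral>x. f x \<partial>fst \<nu>) - (\<integral>x. f x \<partial>snd \<nu>)"

definition signed :: "real measure \<Rightarrow> signed_measure" where
  "signed \<mu> = (\<mu>, null_measure \<mu>)"

text \<open>The signed measure \<open>w \<mu>\<close>, split into its positive and negative parts
  (\<open>ennreal\<close> maps negative reals to \<open>0\<close>).\<close>

definition signed_density :: "(real \<Rightarrow> real) \<Rightarrow> real measure \<Rightarrow> signed_measure" where
  "signed_density w \<mu> = (density \<mu> (\<lambda>x. ennreal (w x)), density \<mu> (\<lambda>x. ennreal (- w x)))"

text \<open>Weak convergence is tested against bounded continuous functions.\<close>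

definition weak_limit :: "(real \<Rightarrow> signed_measure) \<Rightarrow> real filter \<Rightarrow> signed_measure \<Rightarrow> bool" where
  "weak_limit m F \<nu> \<longleftrightarrow>
     finite_signed \<nu> \<and>
     (\<forall>g. continuous_on UNIV g \<and> bounded (range g) \<longrightarrow> ((\<lambda>s. sint (m s) g) \<longlongrightarrow> sint \<nu> g) F)"

text \<open>The condition on the right says that the limit from the right exists and equals the value at
  \<open>t\<close>; equality of pairs would depend on the representation.\<close>

definition weakly_cadlag :: "(real \<Rightarrow> signed_measure) \<Rightarrow> bool" where
  "weakly_cadlag m \<longleftrightarrow>
     (\<forall>t>0. finite_signed (m t) \<and> (\<exists>\<nu>. weak_limit m (at_left t) \<nu>) \<and> weak_limit m (at_right t) (m t))"

definition left_lim :: "(real \<Rightarrow> signed_measure) \<Rightarrow> real \<Rightarrow> signed_measure" where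
  "left_lim m t = (SOME \<nu>. weak_limit m (at_left t) \<nu>)"

definition right_lim :: "(real \<Rightarrow> signed_measure) \<Rightarrow> real \<Rightarrow> signed_measure" where
  "right_lim m t = (SOME \<nu>. weak_limit m (at_right t) \<nu>)"

text \<open>\<open>jump m t f\<close> is the integral of \<open>f\<close> against \<open>m (\<cdot>, t\<^sup>+) - m (\<cdot>, t\<^sup>-)\<close>. For bounded continuous
  \<open>f\<close> it does not depend on the choices made in the two preceding definitions.\<close>

definition jump :: "(real \<Rightarrow> signed_measure) \<Rightarrow> real \<Rightarrow> (real \<Rightarrow> real) \<Rightarrow> real" where
  "jump m t f = sint (right_lim m t) f - sint (left_lim m t) f"

text \<open>The integral of \<open>f (x)\<close> over \<open>\<real> \<times> ]t1, t2]\<close> against the jump measure \<open>\<Delta> (m)\<close>.\<close>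

definition jump_integral :: "(real \<Rightarrow> signed_measure) \<Rightarrow> real \<Rightarrow> real \<Rightarrow> (real \<Rightarrow> real) \<Rightarrow> real" where
  "jump_integral m t1 t2 f = (\<Sum>\<^sub>\<infinity>t\<in>{t1<..t2}. jump m t f)"

definition C1_0 :: "(real \<Rightarrow> real) set" where
  "C1_0 = {f. f C1_differentiable_on UNIV \<and> compact (closure {x. f x \<noteq> 0})}"

definition C_0 :: "(real \<Rightarrow> real) set" where
  "C_0 = {g. continuous_on UNIV g \<and> compact (closure {x. g x \<noteq> 0})}"

end

theory Submission
  imports Defs
begin

text \<open>
  Clusters change only at the finitely many shock times, and in between every particle of a cluster
  has velocity \<open>A + t B\<close>, where \<open>A\<close> and \<open>B\<close> are the averages of \<open>u\<^sub>0\<close> and \<open>\<gamma>\<^sub>0\<close> over the cluster, so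
  that \<open>\<Gamma>\<^sub>t = B\<close>. Hence \<open>E[f(V\<^sub>t) \<Gamma>\<^sub>t\<^sup>n]\<close> has derivative \<open>E[f'(V\<^sub>t) \<Gamma>\<^sub>t\<^sup>n\<^sup>+\<^sup>1]\<close> away from the shock
  times, and the two balance laws are the fundamental theorem of calculus with jumps for \<open>n = 0\<close> and
  \<open>n = 1\<close>. The moments are expressed through \<open>w\<close> and \<open>a\<close> because \<open>V\<^sub>t\<close> is a function of the cluster,
  which gives \<open>w = E[\<Gamma>\<^sub>0 | V\<^sub>t] = E[\<Gamma>\<^sub>t | V\<^sub>t]\<close> and \<open>w\<^sup>2 + a = E[\<Gamma>\<^sub>t\<^sup>2 | V\<^sub>t]\<close>.
\<close>

section \<open>Functions with finitely many jumps\<close>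

text \<open>Distinct clusters may share a velocity, so conditioning on V_t is coarser than knowing
  the cluster. This is where a nonzero a comes from, and why the argument runs on the unconditional
  moments E[g(V_t) \<Gamma>_t^n], which are finite sums over particles. The functions w and a are
  arbitrary versions, chosen separately at each time: nothing links them across times, and even the
  integrability in t of the fluxes comes from recognising them as moments. The moments take the
  partition and the time as separate arguments, because at a shock the left limit pairs the shock
  time with the partition before the merger. The initial condition on a\<mu> is a limit and not a
  value at time 0: particles with equal initial velocities and different accelerations give
  Var[\<Gamma>_0 | V_0] > 0, but for small t > 0 their velocities have split.\<close>

lemma fundamental_theorem_of_calculus_jumps:
  fixes F F' L :: "real \<Rightarrow> real"
  assumes "finite T" and "a < b"
    and right: "\<And>t. a \<le> t \<Longrightarrow> (F \<longlongrightarrow> F t) (at_right t)"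
    and left: "\<And>t. a < t \<Longrightarrow> (F \<longlongrightarrow> L t) (at_left t)"
    and no_jump: "\<And>t. a < t \<Longrightarrow> t \<notin> T \<Longrightarrow> L t = F t"
    and deriv: "\<And>t. a < t \<Longrightarrow> t \<notin> T \<Longrightarrow> (F has_real_derivative F' t) (at t)"
    and cont: "\<And>t. a < t \<Longrightarrow> t \<notin> T \<Longrightarrow> isCont F' t"
    and bound: "\<And>t. a \<le> t \<Longrightarrow> \<bar>F' t\<bar> \<le> C"
  shows "set_integrable lborel {a..b} F'"
    and "(\<lambda>t. F t - L t) summable_on {a<..b}"
    and "F b - F a = (LBINT t:{a..b}. F' t) + (\<Sum>\<^sub>\<infinity>t\<in>{a<..b}. F t - L t)"
proof -
  \<comment> \<open>Only jumps in \<open>{a<..b}\<close> count; at \<open>a\<close> itself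
    right-continuity is enough.\<close>
  define T' where "T' = T \<inter> {a<..b}"
  define c where "c s = F s - L s" for s
  define step where "step s t = (if s \<le> t then c s else 0)" for s t
  \<comment> \<open>\<open>J\<close> is right-continuous and has the jumps of \<open>F\<close>, so
    \<open>H = F - J\<close> is continuous and the ordinary theorem with finitely many exceptional
    points applies to it.\<close>
  define J where "J t = (\<Sum>s\<in>T'. step s t)" for t
  have T': "finite T'" using \<open>finite T\<close> by (simp add: T'_def)
  have J_right: "(J \<longlongrightarrow> J t) (at_right t)" for t
    unfolding J_def
  proof (intro tendsto_sum tendsto_eventually)
    fix s
    show "\<forall>\<^sub>F x in at_right t. step s x = step s t"
    proof (cases "s \<le> t")
      case True
      then show ?thesis unfolding eventually_at_right_field step_def by (intro exI[of _ "t + 1"]) auto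
    next
      case False
      then show ?thesis unfolding eventually_at_right_field step_def by (intro exI[of _ s]) auto
    qed
  qed
  have J_left: "(J \<longlongrightarrow> J t - c t) (at_left t)" if "a < t" "t \<le> b" for t
  proof -
    have "(J \<longlongrightarrow> (\<Sum>s\<in>T'. step s t - (if s = t then c t else 0))) (at_left t)"
      unfolding J_def
    proof (intro tendsto_sum tendsto_eventually)
      fix s
      show "\<forall>\<^sub>F x in at_left t. step s x = step s t - (if s = t then c t else 0)"
      proof (cases "s < t")
        case True
        then show ?thesis unfolding eventually_at_left_field step_def by (intro exI[of _ s]) auto
      next
        case False
        then show ?thesis unfolding eventually_at_left_field step_def by (intro exI[of _ "t - 1"]) auto
      qed
    qed
    \<comment> \<open>For t outside \<open>T'\<close> the sum contains no correction, and then
      \<open>c t = 0\<close> by \<open>no_jump\<close>.\<close>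
    moreover have "(\<Sum>s\<in>T'. step s t - (if s = t then c t else 0)) = J t - c t"
      using that no_jump[of t] T' by (auto simp: J_def sum_subtractf T'_def c_def)
    ultimately show ?thesis by simp
  qed
  have J_deriv: "(J has_real_derivative 0) (at t)" if "t \<notin> T'" for t
  proof -
    have "(step s has_real_derivative 0) (at t)" if "s \<noteq> t" for s
    proof (cases "s < t")
      case True
      have "((\<lambda>_. c s) has_real_derivative 0) (at t)" by simp
      then show ?thesis
        by (rule has_field_derivative_transform_within_open[where S = "{s<..}"]) (use True in \<open>auto simp: step_def\<close>)
    next
      case False
      have "((\<lambda>_. 0) has_real_derivative 0) (at t)" by simp
      then show ?thesis
        by (rule has_field_derivative_transform_within_open[where S = "{..<s}"]) (use False that in \<open>auto simp: step_def\<close>)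
    qed
    then have "((\<lambda>t. \<Sum>s\<in>T'. step s t) has_real_derivative (\<Sum>s\<in>T'. 0)) (at t)"
      using that by (intro DERIV_sum) metis
    then show ?thesis by (simp add: J_def[abs_def])
  qed
  define H where "H t = F t - J t" for t
  have H_right: "(H \<longlongrightarrow> H t) (at_right t)" if "a \<le> t" for t
    unfolding H_def using right[OF that] J_right by (rule tendsto_diff)
  have H_left: "(H \<longlongrightarrow> H t) (at_left t)" if "a < t" "t \<le> b" for t
    using tendsto_diff[OF left[OF that(1)] J_left[OF that]] by (simp add: H_def[abs_def] c_def)
  have "continuous_on {a..b} H"
  proof (rule continuous_on_IccI[OF _ _ _ \<open>a < b\<close>])
    show "H \<midarrow>t\<rightarrow> H t" if "a < t" "t < b" for t
      using filterlim_split_at[OF H_left H_right] that by simp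
  qed (use H_right H_left \<open>a < b\<close> in auto)
  moreover have "(H has_vector_derivative F' t) (at t)" if "t \<in> {a<..<b} - T" for t
    using DERIV_diff[OF deriv J_deriv, of t] that
    by (simp add: H_def[abs_def] T'_def has_real_derivative_iff_has_vector_derivative)
  ultimately have int: "(F' has_integral H b - H a) {a..b}"
    using fundamental_theorem_of_calculus_interior_strong[OF \<open>finite T\<close>, of a b H F'] \<open>a < b\<close> by auto
  \<comment> \<open>The gauge integral just obtained does not yield Lebesgue integrability. That
    comes from measurability, by continuity off a finite set, and the bound
    \<open>C\<close>.\<close>
  show integrable: "set_integrable lborel {a..b} F'"
  proof -
    let ?A = "{a<..<b} - T" and ?f = "\<lambda>x. indicator {a..b} x *\<^sub>R F' x"
    have "?A \<in> sets borel"
      using \<open>finite T\<close> by (intro borel_open open_Diff finite_imp_closed) auto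
    moreover have "continuous_on ?A F'"
      using cont by (intro continuous_at_imp_continuous_on) auto
    ultimately have "(\<lambda>x. indicator ?A x *\<^sub>R F' x) \<in> borel_measurable borel"
      by (rule borel_measurable_continuous_on_indicator)
    then have "?f \<in> borel_measurable borel"
    proof (rule measurable_discrete_difference[where X = "T \<union> {a,b}"])
      show "countable (T \<union> {a,b})" using \<open>finite T\<close> by (simp add: countable_finite)
      show "indicator ?A x *\<^sub>R F' x = ?f x" if "x \<notin> T \<union> {a,b}" for x
        using that by (simp add: indicator_def) linarith
    qed auto
    then have "integrable lborel (\<lambda>x. indicator {a..b} x *\<^sub>R ?f x)"
      using bound \<open>a < b\<close>
      by (intro integrableI_bounded_set_indicator[where B = C]) (auto simp: emeasure_lborel_Icc_eq indicator_def)
    then show ?thesis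
      by (simp add: set_integrable_def mult.assoc[symmetric] indicator_inter_arith[symmetric])
  qed
  have "(\<lambda>t. F t - L t) summable_on T'" using T' by simp
  then show "(\<lambda>t. F t - L t) summable_on {a<..b}"
    by (rule summable_on_cong_neutral[THEN iffD1, rotated -1]) (auto simp: T'_def no_jump)
  have "(\<Sum>\<^sub>\<infinity>t\<in>{a<..b}. F t - L t) = (\<Sum>\<^sub>\<infinity>t\<in>T'. F t - L t)"
    by (rule infsum_cong_neutral) (auto simp: T'_def no_jump)
  also have "\<dots> = (\<Sum>t\<in>T'. F t - L t)" using T' by simp
  also have "\<dots> = J b - J a"
    by (auto simp: J_def step_def c_def T'_def sum_subtractf intro!: sum.neutral sum.cong)
  finally show "F b - F a = (LBINT t:{a..b}. F' t) + (\<Sum>\<^sub>\<infinity>t\<in>{a<..b}. F t - L t)"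
    using set_borel_integral_eq_integral(2)[OF integrable] int
    by (simp add: H_def integral_unique)
qed

section \<open>Compactly supported test functions\<close>

lemma C_0_bounded:
  assumes "g \<in> C_0"
  obtains C where "\<And>x. \<bar>g x\<bar> \<le> C"
proof -
  let ?K = "closure {x. g x \<noteq> 0}"
  have "compact (g ` ?K)"
    using assms by (intro compact_continuous_image) (auto simp: C_0_def intro: continuous_on_subset)
  then have "bounded (g ` ?K)" by (rule compact_imp_bounded)
  then obtain C where C: "\<And>y. y \<in> g ` ?K \<Longrightarrow> \<bar>y\<bar> \<le> C"
    unfolding bounded_iff real_norm_def by blast
  have "\<bar>g x\<bar> \<le> max C 0" for x
  proof (cases "g x = 0")
    case False
    then have "x \<in> ?K" using closure_subset[of "{x. g x \<noteq> 0}"] by auto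
    then show ?thesis using C[OF imageI] by (simp add: le_max_iff_disj)
  qed simp
  then show thesis using that by blast
qed

text \<open>Lets \<open>deriv f\<close> serve as a test function in the flux terms; it vanishes off
  the closed support of \<open>f\<close> because \<open>f\<close> is locally zero there.\<close>

lemma C1_0_D:
  assumes "f \<in> C1_0"
  shows "f \<in> C_0" "(f has_real_derivative deriv f x) (at x)" "deriv f \<in> C_0"
proof -
  obtain f' where f': "\<And>x. (f has_vector_derivative f' x) (at x)" "continuous_on UNIV f'"
    using assms by (auto simp: C1_0_def C1_differentiable_on_def)
  have der: "(f has_real_derivative f' x) (at x)" for x
    using f'(1) by (simp add: has_real_derivative_iff_has_vector_derivative)
  then have eq: "deriv f = f'" using DERIV_imp_deriv by blast
  show "(f has_real_derivative deriv f x) (at x)" using der eq by simp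
  show "f \<in> C_0"
    using assms DERIV_isCont[OF der] by (simp add: C_0_def C1_0_def continuous_on_eq_continuous_at)
  let ?K = "closure {x. f x \<noteq> 0}"
  have "deriv f x = 0" if "x \<notin> ?K" for x
  proof -
    have "((\<lambda>_. 0) has_real_derivative 0) (at x)" by simp
    then have "(f has_real_derivative 0) (at x)"
      by (rule has_field_derivative_transform_within_open[where S = "- ?K"])
        (use that closure_subset[of "{x. f x \<noteq> 0}"] in auto)
    then show ?thesis by (rule DERIV_imp_deriv)
  qed
  then have "closure {x. deriv f x \<noteq> 0} \<subseteq> ?K" by (intro closure_minimal) auto
  moreover have "compact ?K" using assms by (simp add: C1_0_def)
  ultimately have "compact (closure {x. deriv f x \<noteq> 0})"
    using compact_Int_closed[of ?K "closure {x. deriv f x \<noteq> 0}"] by (simp add: Int_absorb1)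
  then show "deriv f \<in> C_0" using f'(2) eq by (simp add: C_0_def)
qed

lemma C_0_continuous: "g \<in> C_0 \<Longrightarrow> continuous_on UNIV g"
  by (simp add: C_0_def)

lemma C_0_measurable: "g \<in> C_0 \<Longrightarrow> g \<in> borel_measurable borel"
  by (rule borel_measurable_continuous_onI[OF C_0_continuous])

lemma bounded_range_iff_abs: "bounded (range (g :: real \<Rightarrow> real)) \<longleftrightarrow> (\<exists>C. \<forall>x. \<bar>g x\<bar> \<le> C)"
  by (auto simp: bounded_iff)

section \<open>Signed measures and conditioning\<close>

text \<open>Supplies the left limit of a field at a given time as a sum of point masses. The
  coefficients may be negative; the witness splits each into positive and negative part.\<close>

lemma signed_point_measure:
  assumes "finite A"
  shows "\<exists>\<nu>. finite_signed \<nu> \<and> (\<forall>g\<in>borel_measurable borel. sint \<nu> g = (\<Sum>y\<in>A. c y * g (z y)))"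
proof -
  define M where "M d = distr (point_measure A (\<lambda>y. ennreal (d y))) borel z" for d :: "'a \<Rightarrow> real"
  have z: "z \<in> measurable (point_measure A (\<lambda>y. ennreal (d y))) borel" for d :: "'a \<Rightarrow> real"
    by (auto simp: measurable_def space_point_measure sets_point_measure)
  have fin: "finite_measure (M d)" for d
    unfolding M_def using assms
    by (intro finite_measure.finite_measure_distr z finite_measureI)
      (simp add: space_point_measure emeasure_point_measure_finite)
  have int: "(\<integral>x. g x \<partial>M (\<lambda>y. max 0 (d y))) = (\<Sum>y\<in>A. max 0 (d y) * g (z y))"
    if "g \<in> borel_measurable borel" for g d
    unfolding M_def integral_distr[OF z that]
    by (subst lebesgue_integral_point_measure_finite) (use assms in auto)
  show ?thesis
  proof (intro exI[of _ "(M (\<lambda>y. max 0 (c y)), M (\<lambda>y. max 0 (- c y)))"] conjI ballI)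
    show "finite_signed (M (\<lambda>y. max 0 (c y)), M (\<lambda>y. max 0 (- c y)))"
      using fin by (simp add: finite_signed_def M_def)
    show "sint (M (\<lambda>y. max 0 (c y)), M (\<lambda>y. max 0 (- c y))) g = (\<Sum>y\<in>A. c y * g (z y))"
      if "g \<in> borel_measurable borel" for g :: "real \<Rightarrow> real"
      unfolding sint_def fst_conv snd_conv int[OF that] sum_subtractf[symmetric]
      by (rule sum.cong) (auto simp: max_def)
  qed
qed

text \<open>The one-sided limit measures are arbitrary choices, but uniqueness of limits of real
  functions fixes their integrals against bounded continuous functions.\<close>

lemma jump_eq:
  assumes "weakly_cadlag m" "t > 0" "continuous_on UNIV g" "bounded (range g)"
    and l: "((\<lambda>s. sint (m s) g) \<longlongrightarrow> l) (at_left t)"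
  shows "jump m t g = sint (m t) g - l"
proof -
  have right: "weak_limit m (at_right t) (m t)" and "\<exists>\<nu>. weak_limit m (at_left t) \<nu>"
    using assms(1,2) by (auto simp: weakly_cadlag_def)
  then have "weak_limit m (at_right t) (right_lim m t)" "weak_limit m (at_left t) (left_lim m t)"
    unfolding right_lim_def left_lim_def by (auto intro: someI someI_ex)
  then have "((\<lambda>s. sint (m s) g) \<longlongrightarrow> sint (right_lim m t) g) (at_right t)"
    "((\<lambda>s. sint (m s) g) \<longlongrightarrow> sint (left_lim m t) g) (at_left t)"
    using assms(3,4) by (auto simp: weak_limit_def)
  moreover have "((\<lambda>s. sint (m s) g) \<longlongrightarrow> sint (m t) g) (at_right t)"
    using right assms(3,4) by (auto simp: weak_limit_def)
  ultimately have "sint (right_lim m t) g = sint (m t) g" "sint (left_lim m t) g = l"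
    using l tendsto_unique trivial_limit_at_right_real trivial_limit_at_left_real by blast+
  then show ?thesis by (simp add: jump_def)
qed

lemma sint_signed: "sint (signed \<mu>) g = (\<integral>x. g x \<partial>\<mu>)"
  by (simp add: sint_def signed_def)

lemma finite_signed_signed:
  assumes "finite_measure \<mu>" "sets \<mu> = sets borel"
  shows "finite_signed (signed \<mu>)"
  using assms by (auto simp: finite_signed_def signed_def intro!: finite_measureI)

lemma finite_signed_density:
  assumes "integrable \<mu> d" "sets \<mu> = sets borel"
  shows "finite_signed (signed_density d \<mu>)"
proof -
  have "finite_measure (density \<mu> (\<lambda>x. ennreal (e x)))" if [measurable]: "integrable \<mu> e" for e
  proof (rule finite_measureI)
    have "emeasure (density \<mu> (\<lambda>x. ennreal (e x))) (space \<mu>) = (\<integral>\<^sup>+x. ennreal (e x) \<partial>\<mu>)"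
      using that by (subst emeasure_density) (auto intro!: nn_integral_cong)
    also have "\<dots> \<le> (\<integral>\<^sup>+x. ennreal (norm (e x)) \<partial>\<mu>)" by (intro nn_integral_mono ennreal_leI) simp
    also have "\<dots> < \<infinity>" using that by (simp add: integrable_iff_bounded)
    finally show "emeasure (density \<mu> (\<lambda>x. ennreal (e x))) (space (density \<mu> (\<lambda>x. ennreal (e x)))) \<noteq> \<infinity>"
      by simp
  qed
  from this[of d] this[of "\<lambda>x. - d x"] show ?thesis
    using assms by (simp add: finite_signed_def signed_density_def)
qed

lemma sint_signed_density:
  assumes d: "integrable \<mu> d" and "sets \<mu> = sets borel"
    and g [measurable]: "g \<in> borel_measurable borel" and bound: "\<And>x. \<bar>g x\<bar> \<le> C"
  shows "sint (signed_density d \<mu>) g = (\<integral>x. g x * d x \<partial>\<mu>)"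
proof -
  have [measurable_cong]: "sets \<mu> = sets borel" by fact
  have [measurable]: "d \<in> borel_measurable \<mu>" using d by simp
  \<comment> \<open>Makes explicit the truncation hidden in \<open>ennreal\<close>, so that
    \<open>integral_density\<close> sees a nonnegative real density.\<close>
  have dens: "density \<mu> (\<lambda>x. ennreal (e x)) = density \<mu> (\<lambda>x. ennreal (max 0 (e x)))" for e
    by (rule arg_cong[of _ _ "density \<mu>"]) (simp add: fun_eq_iff max_def ennreal_neg)
  have int: "integrable \<mu> (\<lambda>x. max 0 (e x) *\<^sub>R g x)" if [measurable]: "integrable \<mu> e" for e
  proof (rule Bochner_Integration.integrable_bound[of _ "\<lambda>x. C * e x"])
    have "\<bar>max 0 (e x) * g x\<bar> \<le> \<bar>C * e x\<bar>" for x
      unfolding abs_mult mult.commute[of "\<bar>C\<bar>"]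
      using bound[of x] by (intro mult_mono) (auto simp: max_def)
    then show "AE x in \<mu>. norm (max 0 (e x) *\<^sub>R g x) \<le> norm (C * e x)" by simp
  qed (use that in auto)
  have "sint (signed_density d \<mu>) g = (\<integral>x. max 0 (d x) *\<^sub>R g x \<partial>\<mu>) - (\<integral>x. max 0 (- d x) *\<^sub>R g x \<partial>\<mu>)"
    unfolding sint_def signed_density_def fst_conv snd_conv dens[of d] dens[of "\<lambda>x. - d x"]
    by (subst (1 2) integral_density) auto
  also have "\<dots> = (\<integral>x. max 0 (d x) *\<^sub>R g x - max 0 (- d x) *\<^sub>R g x \<partial>\<mu>)"
    using int[of d] int[of "\<lambda>x. - d x"] d by (intro Bochner_Integration.integral_diff[symmetric]) auto
  also have "\<dots> = (\<integral>x. g x * d x \<partial>\<mu>)"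
    by (rule Bochner_Integration.integral_cong) (auto simp: max_def)
  finally show ?thesis .
qed

section \<open>Conditional expectation given a real random variable\<close>

context prob_space
begin

lemma finite_measure_subalgebra_vimage:
  assumes "Y \<in> borel_measurable M"
  shows "finite_measure_subalgebra M (vimage_algebra (space M) Y borel)"
  by unfold_locales (auto simp: subalgebra_def sets_vimage_algebra2 intro: measurable_sets[OF assms])

lemma measurable_vimage_comp:
  assumes "k \<in> borel_measurable borel"
  shows "(\<lambda>\<omega>. k (Y \<omega>)) \<in> borel_measurable (vimage_algebra (space M) Y (borel :: real measure))"
  by (rule measurable_compose[OF measurable_vimage_algebra1 assms]) auto

text \<open>\<open>k (Y)\<close> is measurable for the sigma-algebra of \<open>Y\<close>, so it can
  be moved inside the conditional expectation.\<close>

lemma is_cond_exp_at_integral: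
  assumes g: "is_cond_exp_at M Z Y g" and Z: "integrable M Z"
    and Y [measurable]: "Y \<in> borel_measurable M"
    and k [measurable]: "k \<in> borel_measurable borel" and bound: "\<And>x. \<bar>k x\<bar> \<le> (C::real)"
  shows "integrable M (\<lambda>\<omega>. k (Y \<omega>) * g (Y \<omega>))"
    and "(\<integral>\<omega>. k (Y \<omega>) * g (Y \<omega>) \<partial>M) = (\<integral>\<omega>. k (Y \<omega>) * Z \<omega> \<partial>M)"
proof -
  let ?F = "vimage_algebra (space M) Y borel"
  interpret F: finite_measure_subalgebra M ?F by (rule finite_measure_subalgebra_vimage[OF Y])
  have [measurable]: "g \<in> borel_measurable borel" "Z \<in> borel_measurable M"
    using g Z by (auto simp: is_cond_exp_at_def)
  have kZ: "integrable M (\<lambda>\<omega>. k (Y \<omega>) * Z \<omega>)"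
    by (rule Bochner_Integration.integrable_bound[of _ "\<lambda>x. C * Z x"])
      (use Z bound in \<open>auto simp: abs_mult intro!: mult_right_mono AE_I2 intro: order_trans[OF _ abs_ge_self]\<close>)
  note int = F.real_cond_exp_intg[OF kZ measurable_vimage_comp[OF k] \<open>Z \<in> borel_measurable M\<close>]
  have ae: "AE \<omega> in M. k (Y \<omega>) * real_cond_exp M ?F Z \<omega> = k (Y \<omega>) * g (Y \<omega>)"
    using g by (auto simp: is_cond_exp_at_def)
  have [measurable]: "real_cond_exp M ?F Z \<in> borel_measurable M"
    using borel_measurable_cond_exp2 by blast
  show "integrable M (\<lambda>\<omega>. k (Y \<omega>) * g (Y \<omega>))"
    by (rule integrable_cong_AE_imp[OF int(1) _ ae]) measurable
  have "(\<integral>\<omega>. k (Y \<omega>) * g (Y \<omega>) \<partial>M) = (\<integral>\<omega>. k (Y \<omega>) * real_cond_exp M ?F Z \<omega> \<partial>M)"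
    using ae by (intro integral_cong_AE) (auto elim: eventually_mono)
  with int(2) show "(\<integral>\<omega>. k (Y \<omega>) * g (Y \<omega>) \<partial>M) = (\<integral>\<omega>. k (Y \<omega>) * Z \<omega> \<partial>M)" by simp
qed

text \<open>Events of the sigma-algebra of \<open>Y\<close> are preimages of Borel sets, so
  integrals against bounded functions of \<open>Y\<close> determine the conditional expectation.
  Meant for \<Gamma>_0 and \<Gamma>_t, which differ as random variables but agree when tested
  against functions of V_t.\<close>

lemma is_cond_exp_at_unique:
  assumes g: "is_cond_exp_at M Z Y g" and g': "is_cond_exp_at M Z' Y g'"
    and Z: "integrable M Z" and Z': "integrable M Z'"
    and Y [measurable]: "Y \<in> borel_measurable M"
    and eq: "\<And>k C. k \<in> borel_measurable borel \<Longrightarrow> (\<And>x. \<bar>k x\<bar> \<le> (C::real)) \<Longrightarrow>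
       (\<integral>\<omega>. k (Y \<omega>) * Z \<omega> \<partial>M) = (\<integral>\<omega>. k (Y \<omega>) * Z' \<omega> \<partial>M)"
  shows "AE \<omega> in M. g (Y \<omega>) = g' (Y \<omega>)"
proof -
  let ?F = "vimage_algebra (space M) Y borel"
  interpret F: finite_measure_subalgebra M ?F by (rule finite_measure_subalgebra_vimage[OF Y])
  have g'_meas: "g' \<in> borel_measurable borel" using g' by (auto simp: is_cond_exp_at_def)
  have "AE \<omega> in M. real_cond_exp M ?F Z \<omega> = g' (Y \<omega>)"
  proof (rule F.real_cond_exp_charact[OF _ Z])
    show "integrable M (\<lambda>\<omega>. g' (Y \<omega>))"
      using is_cond_exp_at_integral(1)[OF g' Z' Y, of "\<lambda>_. 1" 1] by simp
    show "(\<lambda>\<omega>. g' (Y \<omega>)) \<in> borel_measurable ?F" using measurable_vimage_comp[OF g'_meas] .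
    fix A assume "A \<in> sets ?F"
    then obtain B where B: "B \<in> sets borel" "A = Y -` B \<inter> space M"
      by (auto simp: sets_vimage_algebra2)
    have set_int: "(\<integral>\<omega>\<in>A. h \<omega> \<partial>M) = (\<integral>\<omega>. indicat_real B (Y \<omega>) * h \<omega> \<partial>M)" for h
      unfolding set_lebesgue_integral_def using B(2)
      by (intro Bochner_Integration.integral_cong) (auto simp: indicator_def)
    have k: "indicat_real B \<in> borel_measurable borel" "\<And>x. \<bar>indicat_real B x\<bar> \<le> 1"
      using B by (auto simp: indicator_def)
    show "(\<integral>\<omega>\<in>A. Z \<omega> \<partial>M) = (\<integral>\<omega>\<in>A. g' (Y \<omega>) \<partial>M)"
      unfolding set_int using is_cond_exp_at_integral(2)[OF g' Z' Y k] eq[OF k] by simp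
  qed
  then show ?thesis using g by (auto simp: is_cond_exp_at_def)
qed

lemma is_cond_exp_at_comp:
  assumes "integrable M (\<lambda>\<omega>. k (Y \<omega>))" "Y \<in> borel_measurable M" "k \<in> borel_measurable borel"
  shows "is_cond_exp_at M (\<lambda>\<omega>. k (Y \<omega>)) Y k"
proof -
  interpret F: finite_measure_subalgebra M "vimage_algebra (space M) Y borel"
    by (rule finite_measure_subalgebra_vimage[OF assms(2)])
  show ?thesis
    using F.real_cond_exp_F_meas[OF assms(1) measurable_vimage_comp[OF assms(3)]] assms(3)
    by (auto simp: is_cond_exp_at_def)
qed

text \<open>Used shortly after time 0, when the acceleration is a function of the velocity and its
  conditional variance must vanish.\<close>

lemma is_cond_exp_at_of_function:
  assumes g: "is_cond_exp_at M Z Y g" and Z: "integrable M Z"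
    and Y [measurable]: "Y \<in> borel_measurable M" and k [measurable]: "k \<in> borel_measurable borel"
    and ae: "AE \<omega> in M. Z \<omega> = k (Y \<omega>)"
  shows "AE \<omega> in M. g (Y \<omega>) = k (Y \<omega>)"
proof -
  have [measurable]: "Z \<in> borel_measurable M" using Z by simp
  have int: "integrable M (\<lambda>\<omega>. k (Y \<omega>))" by (rule integrable_cong_AE_imp[OF Z _ ae]) simp
  show ?thesis
  proof (rule is_cond_exp_at_unique[OF g is_cond_exp_at_comp[OF int Y k] Z int Y])
    fix h :: "real \<Rightarrow> real" assume [measurable]: "h \<in> borel_measurable borel"
    show "(\<integral>\<omega>. h (Y \<omega>) * Z \<omega> \<partial>M) = (\<integral>\<omega>. h (Y \<omega>) * k (Y \<omega>) \<partial>M)"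
      using ae by (intro integral_cong_AE) (auto elim: eventually_mono)
  qed
qed

end

section \<open>Clusters and shock times\<close>

text \<open>Clusters are sets of positions, so masses are reindexed by position; positions are
  distinct, hence \<open>inv_into\<close> recovers the particle.\<close>

definition weight :: "particles \<Rightarrow> real \<Rightarrow> real" where
  "weight D y = mass D (inv_into {1..num D} (pos D) y)"

text \<open>Position, velocity and acceleration of a cluster are all means of this form.\<close>

definition average :: "particles \<Rightarrow> (real \<Rightarrow> real) \<Rightarrow> real set \<Rightarrow> real" where
  "average D h G = (\<Sum>y\<in>G. weight D y * h y) / (\<Sum>y\<in>G. weight D y)"

text \<open>The analogue of \<open>cluster_of\<close> for an arbitrary partition, so that the
  partition can stay fixed while time varies.\<close>

definition cell :: "'a set set \<Rightarrow> 'a \<Rightarrow> 'a set" where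
  "cell \<xi> y = \<Union>{G \<in> \<xi>. y \<in> G}"

lemma cell_eq:
  assumes "partition_on A \<xi>" "G \<in> \<xi>" "y \<in> G"
  shows "cell \<xi> y = G"
proof -
  have "{G' \<in> \<xi>. y \<in> G'} = {G}"
    using assms by (auto simp: partition_on_def disjoint_def)
  then show ?thesis by (simp add: cell_def)
qed

lemma cell_mem:
  assumes "partition_on A \<xi>" "y \<in> A"
  shows "cell \<xi> y \<in> \<xi>" "y \<in> cell \<xi> y"
  using assms cell_eq[OF assms(1)] by (auto simp: partition_on_def)

lemma cell_subset: "partition_on A \<xi> \<Longrightarrow> cell \<xi> y \<subseteq> A"
  by (auto simp: partition_on_def cell_def)

lemma cell_outside: "partition_on A \<xi> \<Longrightarrow> y \<notin> A \<Longrightarrow> cell \<xi> y = {}"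
  by (auto simp: partition_on_def cell_def)

text \<open>A point common to two unions lies in a single block of \<open>P\<close>, and the value
  of \<open>f\<close> on that block determines the union. With \<open>f\<close> the position at a
  shock this is the merging rule.\<close>

lemma partition_on_fibre_unions:
  assumes "partition_on A P"
  shows "partition_on A ((\<lambda>G. \<Union>{G'\<in>P. f G' = f G}) ` P)"
proof (rule partition_onI)
  note disj = partition_onD2[OF assms, unfolded disjoint_def]
  show "\<Union>((\<lambda>G. \<Union>{G'\<in>P. f G' = f G}) ` P) = A"
    using partition_onD1[OF assms] by auto
  show "{} \<notin> (\<lambda>G. \<Union>{G'\<in>P. f G' = f G}) ` P"
  proof
    assume "{} \<in> (\<lambda>G. \<Union>{G'\<in>P. f G' = f G}) ` P"
    then obtain G where "G \<in> P" "\<Union>{G'\<in>P. f G' = f G} = {}" by auto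
    then have "G = {}" "G \<in> P" by auto
    then show False using partition_onD3[OF assms] by simp
  qed
  fix p q assume p: "p \<in> (\<lambda>G. \<Union>{G'\<in>P. f G' = f G}) ` P"
    and q: "q \<in> (\<lambda>G. \<Union>{G'\<in>P. f G' = f G}) ` P" and "p \<noteq> q"
  from p q obtain G H where G: "G \<in> P" "p = \<Union>{G'\<in>P. f G' = f G}"
    and H: "H \<in> P" "q = \<Union>{G'\<in>P. f G' = f H}" by blast
  show "disjnt p q"
  proof (rule ccontr)
    assume "\<not> disjnt p q"
    then obtain x where "x \<in> p" "x \<in> q" by (auto simp: disjnt_def)
    then obtain G' H' where *: "G' \<in> P" "f G' = f G" "x \<in> G'" "H' \<in> P" "f H' = f H" "x \<in> H'"
      using G H by blast
    then have "G' = H'" using disj by blast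
    then show False using * G H \<open>p \<noteq> q\<close> by simp
  qed
qed

lemma eventually_neq_at_right: "\<forall>\<^sub>F s in at_right (t::real). s \<noteq> c"
proof (cases "t < c")
  case True
  then show ?thesis unfolding eventually_at_right_field by (intro exI[of _ c]) auto
next
  case False
  then show ?thesis unfolding eventually_at_right_field by (intro exI[of _ "t+1"]) auto
qed

section \<open>Masses, centres and collisions\<close>

locale sticky_particles =
  fixes D :: particles
  assumes particle_system: "particle_system D"
begin

lemma inj_on_pos: "inj_on (pos D) {1..num D}"
  using particle_system by (auto simp: particle_system_def strict_mono_on_imp_inj_on)

lemma finite_support [simp]: "finite (support D)"
  by (simp add: support_def)

lemma finite_subset_support: "G \<subseteq> support D \<Longrightarrow> finite G"
  using finite_subset[OF _ finite_support] .

lemma weight_pos: "y \<in> support D \<Longrightarrow> weight D y > 0"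
  using particle_system inv_into_into[of y "pos D" "{1..num D}"]
  by (auto simp: particle_system_def weight_def support_def)

lemma sum_mass_eq:
  assumes "G \<subseteq> support D"
  shows "(\<Sum>j | j \<in> {1..num D} \<and> pos D j \<in> G. mass D j * h (pos D j)) = (\<Sum>y\<in>G. weight D y * h y)"
proof (rule sum.reindex_cong[of "pos D", symmetric])
  show "inj_on (pos D) {j \<in> {1..num D}. pos D j \<in> G}"
    by (rule inj_on_subset[OF inj_on_pos]) auto
  show "G = pos D ` {j \<in> {1..num D}. pos D j \<in> G}"
    using assms by (auto simp: support_def)
  show "weight D (pos D j) * h (pos D j) = mass D j * h (pos D j)"
    if "j \<in> {j \<in> {1..num D}. pos D j \<in> G}" for j
    using that inj_on_pos by (simp add: weight_def)
qed

lemma total_weight_pos: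
  assumes "G \<subseteq> support D" "G \<noteq> {}"
  shows "(\<Sum>y\<in>G. weight D y) > 0"
  using assms weight_pos by (intro sum_pos finite_subset_support) auto

lemma centre_eq:
  assumes "G \<subseteq> support D"
  shows "centre D G t = average D (\<lambda>y. y + t * u0 D y + t\<^sup>2 / 2 * \<gamma>0 D y) G"
  using sum_mass_eq[OF assms, of "\<lambda>y. y + t * u0 D y + t\<^sup>2 / 2 * \<gamma>0 D y"]
    sum_mass_eq[OF assms, of "\<lambda>y. 1"]
  by (simp add: centre_def average_def)

lemma average_add: "average D (\<lambda>y. f y + g y) G = average D f G + average D g G"
  by (simp add: average_def distrib_left sum.distrib add_divide_distrib)

lemma average_scale: "average D (\<lambda>y. c * f y) G = c * average D f G"
  by (simp add: average_def sum_distrib_left mult_ac)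

lemma average_mult_total:
  assumes "G \<subseteq> support D"
  shows "average D h G * (\<Sum>y\<in>G. weight D y) = (\<Sum>y\<in>G. weight D y * h y)"
  using total_weight_pos[OF assms] by (cases "G = {}") (auto simp: average_def)

lemma continuous_centre:
  assumes "G \<subseteq> support D"
  shows "continuous_on A (centre D G)"
proof -
  have "centre D G = (\<lambda>t. average D (\<lambda>y. y) G + t * average D (u0 D) G + t\<^sup>2 / 2 * average D (\<gamma>0 D) G)"
    using assms by (simp only: centre_eq average_add average_scale[symmetric] fun_eq_iff simp_thms)
  then show ?thesis by (auto intro!: continuous_intros)
qed

text \<open>Weighted sums add over disjoint blocks, so a mean common to all blocks survives their
  union. This keeps a merged cluster at the point of collision.\<close>

lemma average_Union:
  assumes "finite \<C>" "disjoint \<C>" "\<Union>\<C> \<subseteq> support D" "\<Union>\<C> \<noteq> {}"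
    and "\<And>G. G \<in> \<C> \<Longrightarrow> average D h G = c"
  shows "average D h (\<Union>\<C>) = c"
proof -
  have sub: "G \<subseteq> support D" if "G \<in> \<C>" for G
    using that assms(3) by auto
  have fin: "\<forall>G\<in>\<C>. finite G" using sub finite_subset_support by blast
  have disj: "\<forall>G\<in>\<C>. \<forall>G'\<in>\<C>. G \<noteq> G' \<longrightarrow> G \<inter> G' = {}"
    using assms(2) by (auto simp: disjoint_def)
  have "(\<Sum>y\<in>\<Union>\<C>. weight D y * h y) = (\<Sum>G\<in>\<C>. \<Sum>y\<in>G. weight D y * h y)"
    using sum.Union_disjoint[OF fin disj] by simp
  also have "\<dots> = (\<Sum>G\<in>\<C>. c * (\<Sum>y\<in>G. weight D y))"
    using average_mult_total[OF sub, of _ h] assms(5) by (intro sum.cong) auto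
  also have "\<dots> = c * (\<Sum>y\<in>\<Union>\<C>. weight D y)"
    using sum.Union_disjoint[OF fin disj, of "weight D"] by (simp add: sum_distrib_left)
  finally show ?thesis
    using total_weight_pos[OF assms(3,4)] by (simp add: average_def)
qed

lemma finite_partition: "partition_on (support D) \<xi> \<Longrightarrow> finite \<xi>"
  using finite_elements[OF finite_support] by blast

lemma partition_memD: "partition_on (support D) \<xi> \<Longrightarrow> G \<in> \<xi> \<Longrightarrow> G \<subseteq> support D \<and> G \<noteq> {}"
  by (auto simp: partition_on_def)

text \<open>The invariant of the dynamics: no two clusters occupy the same position.\<close>

abbreviation separated :: "real set set \<Rightarrow> real \<Rightarrow> bool" where
  "separated \<xi> t \<equiv> inj_on (\<lambda>G. centre D G t) \<xi>"

lemma centre_merged: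
  assumes "partition_on (support D) \<xi>" "G \<in> \<xi>"
  shows "centre D (\<Union>{G'\<in>\<xi>. centre D G' t = centre D G t}) t = centre D G t"
proof -
  let ?C = "{G'\<in>\<xi>. centre D G' t = centre D G t}"
  have sub: "\<Union>?C \<subseteq> support D" using assms partition_memD by blast
  have "average D (\<lambda>y. y + t * u0 D y + t\<^sup>2 / 2 * \<gamma>0 D y) (\<Union>?C) = centre D G t"
  proof (rule average_Union[OF _ _ sub])
    show "finite ?C" using finite_partition[OF assms(1)] by auto
    show "disjoint ?C" using assms(1) by (auto simp: partition_on_def disjoint_def)
    show "\<Union>?C \<noteq> {}" using assms partition_memD by blast
    show "average D (\<lambda>y. y + t * u0 D y + t\<^sup>2 / 2 * \<gamma>0 D y) G' = centre D G t" if "G' \<in> ?C" for G'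
      using that assms(1) partition_memD by (subst centre_eq[symmetric]) auto
  qed
  then show ?thesis using centre_eq[OF sub] by simp
qed

lemma partition_merge: "partition_on (support D) \<xi> \<Longrightarrow> partition_on (support D) (merge D \<xi> t)"
  unfolding merge_def by (rule partition_on_fibre_unions)

text \<open>Each merged cluster sits at the common position of its parts, and this position
  determines which parts were united.\<close>

lemma separated_merge: "partition_on (support D) \<xi> \<Longrightarrow> separated (merge D \<xi> t) t"
  unfolding merge_def by (rule inj_onI, elim imageE) (simp only: centre_merged)

text \<open>If merging were injective on the blocks, no two of them would share a position. The
  strict decrease bounds the number of shocks.\<close>

lemma card_merge:
  assumes "partition_on (support D) \<xi>" "\<not> separated \<xi> t"
  shows "card (merge D \<xi> t) < card \<xi>"
proof -
  have "\<not> inj_on (\<lambda>G. \<Union>{G'\<in>\<xi>. centre D G' t = centre D G t}) \<xi>"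
  proof
    assume inj: "inj_on (\<lambda>G. \<Union>{G'\<in>\<xi>. centre D G' t = centre D G t}) \<xi>"
    have "separated \<xi> t" by (rule inj_onI, rule inj_onD[OF inj]) auto
    then show False using assms(2) by simp
  qed
  then show ?thesis
    unfolding merge_def using finite_partition[OF assms(1)]
    by (intro le_neq_implies_less card_image_le) (auto dest: eq_card_imp_inj_on)
qed

text \<open>The collision times after \<open>s\<close> form a closed set, so a finite infimum is
  itself a collision time and lies strictly after \<open>s\<close>.\<close>

lemma next_shock_cases:
  assumes part: "partition_on (support D) \<xi>" and sep: "separated \<xi> s"
  obtains "next_shock D \<xi> (ereal s) = \<infinity>" "\<And>t. t \<ge> s \<Longrightarrow> separated \<xi> t"
  | r where "next_shock D \<xi> (ereal s) = ereal r" "s < r" "\<not> separated \<xi> r"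
      "\<And>t. s \<le> t \<Longrightarrow> t < r \<Longrightarrow> separated \<xi> t"
proof -
  define B where "B = {t. s < t \<and> \<not> separated \<xi> t}"
  have ns: "next_shock D \<xi> (ereal s) = (INF t\<in>B. ereal t)"
    unfolding next_shock_def B_def inj_on_def by (rule arg_cong[of _ _ Inf]) auto
  show thesis
  proof (cases "B = {}")
    case True
    have "separated \<xi> t" if "t \<ge> s" for t
      using True sep that by (cases "t = s") (auto simp: B_def)
    then show thesis using that(1) True ns by (simp add: top_ereal_def)
  next
    case False
    \<comment> \<open>Separation at \<open>s\<close> allows \<open>s < t\<close> to be relaxed to a
      closed half-line; the right side is a finite union of closed coincidence sets.\<close>
    have "B = (\<Union>G\<in>\<xi>. \<Union>G'\<in>\<xi>-{G}. {t\<in>{s..}. centre D G t = centre D G' t})" (is "_ = ?B")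
    proof -
      have "s \<notin> ?B" using sep by (auto simp: inj_on_def)
      then show ?thesis by (auto simp: B_def inj_on_def order_less_le)
    qed
    also have "closed \<dots>"
    proof (intro closed_UN finite_Diff ballI finite_partition[OF part])
      fix G G' assume "G \<in> \<xi>" "G' \<in> \<xi> - {G}"
      then have "continuous_on {s..} (\<lambda>t. centre D G t - centre D G' t)"
        using partition_memD[OF part] by (intro continuous_on_diff continuous_centre) auto
      from continuous_closed_preimage_constant[OF this closed_atLeast, of 0]
      show "closed {t \<in> {s..}. centre D G t = centre D G' t}" by (simp add: vimage_def Int_def)
    qed
    finally have closed: "closed B" .
    have bdd: "bdd_below B" by (rule bdd_belowI[of _ s]) (auto simp: B_def)
    have mem: "Inf B \<in> B" using closed_contains_Inf[OF False bdd closed] .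
    have "(INF t\<in>B. ereal t) = ereal (Inf B)"
      using mem cInf_lower[OF _ bdd] by (intro antisym INF_greatest INF_lower) auto
    moreover have "separated \<xi> t" if "s \<le> t" "t < Inf B" for t
    proof (cases "t = s")
      case False
      then show ?thesis using that cInf_lower[OF _ bdd, of t] by (force simp: B_def)
    qed (use sep in simp)
    ultimately show thesis using that(2)[of "Inf B"] mem ns by (auto simp: B_def)
  qed
qed

section \<open>Stages and shock times\<close>

abbreviation shock :: "nat \<Rightarrow> ereal" where "shock k \<equiv> fst (stage D k)"
abbreviation stage_clusters :: "nat \<Rightarrow> real set set" where "stage_clusters k \<equiv> snd (stage D k)"

definition shock_times :: "real set" where
  "shock_times = {t. t > 0 \<and> (\<exists>k. shock k = ereal t)}"

declare stage.simps(2) [simp del]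

lemma shock_Suc: "shock (Suc k) = next_shock D (stage_clusters k) (shock k)"
  by (simp add: Let_def stage.simps(2))

lemma stage_clusters_Suc:
  "stage_clusters (Suc k) = (if shock (Suc k) = \<infinity> then stage_clusters k
     else merge D (stage_clusters k) (real_of_ereal (shock (Suc k))))"
  by (simp add: Let_def stage.simps(2))

lemma partition_stage_clusters: "partition_on (support D) (stage_clusters k)"
  by (induction k) (auto simp: stage_clusters_Suc partition_on_singletons partition_merge)

lemma next_shock_PInf: "next_shock D \<xi> \<infinity> = \<infinity>"
  by (simp add: next_shock_def top_ereal_def)

text \<open>Every finite shock costs at least one cluster, so the number of clusters plus the number
  of shocks never exceeds the number of particles. This forces \<open>shock k\<close> to become
  infinite.\<close>

lemma stage_finite:
  "shock k = \<infinity> \<or> (\<exists>s\<ge>0. shock k = ereal s \<and> separated (stage_clusters k) s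
     \<and> card (stage_clusters k) + k \<le> card (support D))"
proof (induction k)
  case 0
  have "separated ((\<lambda>y. {y}) ` support D) 0"
  proof (rule inj_onI, elim imageE)
    fix G H y z assume *: "centre D G 0 = centre D H 0" "G = {y}" "y \<in> support D" "H = {z}" "z \<in> support D"
    have "centre D {x} 0 = x" if "x \<in> support D" for x
      using that weight_pos[OF that] by (simp add: centre_eq average_def)
    with * show "G = H" by simp
  qed
  then show ?case using card_image_le[of "support D" "\<lambda>y. {y}"] by (simp add: zero_ereal_def)
next
  case (Suc k)
  then show ?case
  proof
    assume "shock k = \<infinity>"
    then show ?thesis by (simp add: shock_Suc next_shock_PInf)
  next
    assume "\<exists>s\<ge>0. shock k = ereal s \<and> separated (stage_clusters k) s
     \<and> card (stage_clusters k) + k \<le> card (support D)"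
    then obtain s where s: "s \<ge> 0" "shock k = ereal s" "separated (stage_clusters k) s"
      "card (stage_clusters k) + k \<le> card (support D)" by blast
    note part = partition_stage_clusters[of k]
    show ?thesis
    proof (cases rule: next_shock_cases[OF part s(3)])
      case 1
      then show ?thesis by (simp add: shock_Suc s(2))
    next
      case (2 r)
      then have r: "shock (Suc k) = ereal r" by (simp add: shock_Suc s(2))
      then have "stage_clusters (Suc k) = merge D (stage_clusters k) r"
        by (simp add: stage_clusters_Suc)
      then show ?thesis
        using r 2 s(1,4) separated_merge[OF part, of r] card_merge[OF part, of r] by auto
    qed
  qed
qed

lemma shock_less_Suc: "shock k \<noteq> \<infinity> \<Longrightarrow> shock k < shock (Suc k)"
  using stage_finite[of k] next_shock_cases[OF partition_stage_clusters[of k]]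
  by (smt (verit) ereal_less(3) ereal_less_PInfty less_ereal.simps(1) shock_Suc)

lemma mono_shock: "mono shock"
proof (rule incseq_SucI)
  show "shock k \<le> shock (Suc k)" for k
    using shock_less_Suc[of k] by (cases "shock k = \<infinity>") (auto simp: shock_Suc next_shock_PInf)
qed

lemma shock_eventually_PInf: "k > card (support D) \<Longrightarrow> shock k = \<infinity>"
  using stage_finite[of k] by auto

lemma finite_shock_times: "finite shock_times"
proof (rule finite_subset)
  show "shock_times \<subseteq> (\<lambda>k. real_of_ereal (shock k)) ` {..card (support D)}"
  proof
    fix t assume "t \<in> shock_times"
    then obtain k where k: "shock k = ereal t" by (auto simp: shock_times_def)
    then have "k \<le> card (support D)" using shock_eventually_PInf[of k] by force
    then show "t \<in> (\<lambda>k. real_of_ereal (shock k)) ` {..card (support D)}"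
      using k by (intro image_eqI[of _ _ k]) auto
  qed
qed simp

text \<open>Shock times are monotone, so at most one stage interval contains t and the definite
  description in \<open>clusters\<close> selects it.\<close>

lemma clusters_eq:
  assumes "shock k \<le> ereal t" "ereal t < shock (Suc k)"
  shows "clusters D t = stage_clusters k"
proof -
  have "j = k" if j: "shock j \<le> ereal t" "ereal t < shock (Suc j)" for j
  proof (rule ccontr)
    assume "j \<noteq> k"
    then consider "Suc j \<le> k" | "Suc k \<le> j" by linarith
    then show False
      using monoD[OF mono_shock] assms j by cases (meson leD order_trans)+
  qed
  then have "(THE k. shock k \<le> ereal t \<and> ereal t < shock (Suc k)) = k"
    using assms by (intro the_equality conjI) blast+
  then show ?thesis by (simp add: clusters_def)
qed

lemma partition_clusters: "partition_on (support D) (clusters D t)"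
  unfolding clusters_def by (rule partition_stage_clusters)

lemma stage_at:
  assumes "t \<ge> 0"
  obtains k where "shock k \<le> ereal t" "ereal t < shock (Suc k)"
proof -
  \<comment> \<open>The first shock later than t; it is not shock 0, which occurs at time 0, so it
    has a predecessor, and that one is not later than t.\<close>
  define n where "n = (LEAST n. ereal t < shock n)"
  have "ereal t < shock (Suc (card (support D)))" by (simp add: shock_eventually_PInf)
  then have n: "ereal t < shock n" unfolding n_def by (rule LeastI)
  then have "n \<noteq> 0" using assms by (cases n) (auto simp: zero_ereal_def)
  then obtain k where k: "n = Suc k" by (cases n) auto
  then have "\<not> ereal t < shock k" using not_less_Least[of k "\<lambda>n. ereal t < shock n"] by (simp add: n_def)
  then show thesis using n k by (intro that[of k]) auto
qed

lemma clusters_0: "clusters D 0 = (\<lambda>y. {y}) ` support D"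
  using clusters_eq[of 0 0] shock_less_Suc[of 0] by (simp add: zero_ereal_def)

lemma separated_clusters:
  assumes "t \<ge> 0"
  shows "separated (clusters D t) t"
proof -
  obtain k where k: "shock k \<le> ereal t" "ereal t < shock (Suc k)" using stage_at[OF assms] .
  then obtain s where s: "shock k = ereal s" "separated (stage_clusters k) s"
    using stage_finite[of k] by auto
  have "separated (stage_clusters k) t"
    using next_shock_cases[OF partition_stage_clusters s(2)] k s(1)
    by (metis ereal_less_eq(3) less_ereal.simps(1) shock_Suc)
  then show ?thesis using clusters_eq[OF k] by simp
qed

lemma eventually_clusters_at_right:
  assumes "t \<ge> 0"
  shows "\<forall>\<^sub>F s in at_right t. clusters D s = clusters D t"
proof -
  obtain k where k: "shock k \<le> ereal t" "ereal t < shock (Suc k)" using stage_at[OF assms] .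
  obtain b where b: "t < b" "ereal b \<le> shock (Suc k)"
    using ereal_dense2[OF k(2)] by (metis less_ereal.simps(1) less_imp_le)
  have "clusters D s = clusters D t" if "t < s" "s < b" for s
  proof -
    have "shock k \<le> ereal s" using k(1) that(1) by (meson ereal_less_eq(3) less_imp_le order_trans)
    moreover have "ereal s < shock (Suc k)" using b(2) that(2) by (meson less_ereal.simps(1) order_less_le_trans)
    ultimately show ?thesis using clusters_eq[OF k] clusters_eq[of k s] by simp
  qed
  then show ?thesis using b(1) unfolding eventually_at_right_field by blast
qed

lemma eventually_clusters_at_left:
  assumes "t > 0"
  shows "\<exists>\<xi>. (\<forall>\<^sub>F s in at_left t. clusters D s = \<xi>) \<and> (t \<notin> shock_times \<longrightarrow> \<xi> = clusters D t)"
proof -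
  \<comment> \<open>Here \<open>k\<close> is the stage in force just before t: it starts strictly
    before t and lasts at least until t. At a shock this is the preceding stage, otherwise the
    current one.\<close>
  have main: ?thesis
    if lt: "shock k < ereal t" and "ereal t \<le> shock (Suc k)" "t \<notin> shock_times \<Longrightarrow> stage_clusters k = clusters D t" for k
  proof (intro exI[of _ "stage_clusters k"] conjI impI)
    have "shock k \<noteq> \<infinity>" using lt by auto
    then obtain b where b: "b < t" "shock k \<le> ereal b"
      using lt stage_finite[of k] by force
    have "clusters D s = stage_clusters k" if "b < s" "s < t" for s
    proof (rule clusters_eq)
      show "shock k \<le> ereal s" using b(2) \<open>b < s\<close> by (meson ereal_less_eq(3) less_imp_le order_trans)
      show "ereal s < shock (Suc k)"
        using \<open>ereal t \<le> shock (Suc k)\<close> \<open>s < t\<close> by (meson less_ereal.simps(1) order_less_le_trans)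
    qed
    then show "\<forall>\<^sub>F s in at_left t. clusters D s = stage_clusters k"
      using b(1) unfolding eventually_at_left_field by blast
    show "stage_clusters k = clusters D t" if "t \<notin> shock_times" using that by fact
  qed
  obtain k where k: "shock k \<le> ereal t" "ereal t < shock (Suc k)" using stage_at assms less_imp_le by blast
  show ?thesis
  proof (cases "shock k = ereal t")
    case True
    then obtain j where j: "k = Suc j" using assms by (cases k) (auto simp: zero_ereal_def)
    have "shock j < ereal t"
      using shock_less_Suc[of j] monoD[OF mono_shock, of j k] True j by force
    then show ?thesis
      using main[of j] j True assms by (auto simp: shock_times_def)
  next
    case False
    then show ?thesis using main[of k] k clusters_eq[OF k] by auto
  qed
qed

end

section \<open>Velocities, accelerations and their moments\<close>

text \<open>\<open>u0\<close> and \<open>\<gamma>0\<close> are arbitrary functions. Measurability of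
  what is built from them comes from the finite support, off which the relevant functions take one
  default value.\<close>

lemma borel_measurable_constant_off_finite:
  fixes h :: "real \<Rightarrow> real"
  assumes "finite A" "\<And>x. x \<notin> A \<Longrightarrow> h x = c"
  shows "h \<in> borel_measurable borel"
  by (rule measurable_discrete_difference[where f = "\<lambda>_. c" and X = A])
    (use assms in \<open>auto intro: countable_finite\<close>)

context sticky_particles
begin

lemma cluster_of_eq: "cluster_of D y t = cell (clusters D t) y"
  by (simp add: cluster_of_def cell_def)

lemma integral_P0:
  assumes "h \<in> borel_measurable borel"
  shows "(\<integral>y. h y \<partial>P0 D) = (\<Sum>y\<in>support D. weight D y * h y)"
proof -
  have mass: "j \<in> {1..num D} \<Longrightarrow> 0 \<le> mass D j" for j
    using particle_system by (auto simp: particle_system_def less_imp_le)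
  have "(\<integral>y. h y \<partial>P0 D) = (\<integral>j. h (pos D j) \<partial>point_measure {1..num D} (\<lambda>j. ennreal (mass D j)))"
    unfolding P0_def using assms
    by (intro integral_distr) (auto simp: measurable_def space_point_measure sets_point_measure)
  also have "\<dots> = (\<Sum>j\<in>{1..num D}. mass D j * h (pos D j))"
    using mass by (subst lebesgue_integral_point_measure_finite) auto
  also have "\<dots> = (\<Sum>y\<in>support D. weight D y * h y)"
  proof -
    have "{j. j \<in> {1..num D} \<and> pos D j \<in> support D} = {1..num D}" by (auto simp: support_def)
    then show ?thesis using sum_mass_eq[OF order_refl, of h] by simp
  qed
  finally show ?thesis .
qed

text \<open>The velocity of the particle if the partition were frozen at \<open>\<xi>\<close>; for
  fixed \<open>\<xi>\<close> it is affine in time.\<close>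

definition line :: "real set set \<Rightarrow> real \<Rightarrow> real \<Rightarrow> real" where
  "line \<xi> y t = average D (u0 D) (cell \<xi> y) + t * average D (\<gamma>0 D) (cell \<xi> y)"

definition slope :: "real set set \<Rightarrow> real \<Rightarrow> real" where
  "slope \<xi> y = average D (\<gamma>0 D) (cell \<xi> y)"

lemma line_has_derivative: "(line \<xi> y has_real_derivative slope \<xi> y) (at t within A)"
  unfolding line_def[abs_def] slope_def by (auto intro!: derivative_eq_intros)

lemma vel_eq: "vel D y t = line (clusters D t) y t"
proof -
  define G where "G = cell (clusters D t) y"
  have G: "G \<subseteq> support D" unfolding G_def by (rule cell_subset[OF partition_clusters])
  then have fin: "finite G" by (rule finite_subset_support)
  have int: "(LINT \<eta>:G|P0 D. h \<eta>) = (\<Sum>y\<in>G. weight D y * h y)" for h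
  proof -
    have "(\<lambda>\<eta>. indicat_real G \<eta> * h \<eta>) \<in> borel_measurable borel"
      by (rule borel_measurable_constant_off_finite[OF fin, of _ 0]) (simp add: indicator_def)
    then have "(LINT \<eta>:G|P0 D. h \<eta>) = (\<Sum>y\<in>support D. weight D y * (indicat_real G y * h y))"
      by (simp add: set_lebesgue_integral_def integral_P0)
    also have "\<dots> = (\<Sum>y\<in>G. weight D y * h y)"
      using G by (intro sum.mono_neutral_cong_right) auto
    finally show ?thesis .
  qed
  have "G \<in> sets (P0 D)" using fin by (auto simp: P0_def finite_imp_closed)
  then have "measure (P0 D) G = (LINT \<eta>:G|P0 D. 1)"
    by (simp add: set_lebesgue_integral_def)
  then have "vel D y t = average D (\<lambda>\<eta>. u0 D \<eta> + t * \<gamma>0 D \<eta>) G"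
    unfolding vel_def cluster_of_eq G_def[symmetric] int average_def by simp
  then show ?thesis by (simp add: average_add average_scale line_def G_def)
qed

text \<open>\<open>u\<close> is defined through positions; it is well defined because clusters at
  the same time are separated, so the position determines the cluster.\<close>

lemma velocity_eq:
  assumes "y \<in> support D" "t \<ge> 0"
  shows "u D (\<phi> D y t) t = line (clusters D t) y t"
proof -
  have "vel D z t = vel D y t" if "z \<in> support D" "\<phi> D z t = \<phi> D y t" for z
  proof -
    have "cluster_of D z t = cluster_of D y t"
      using that assms separated_clusters[OF assms(2)] cell_mem(1)[OF partition_clusters]
      unfolding \<phi>_def cluster_of_eq by (auto dest: inj_onD)
    then show ?thesis by (simp add: vel_def)
  qed
  then have "u D (\<phi> D y t) t = vel D y t"
    unfolding u_def using assms(1) by (intro the_equality) blast+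
  then show ?thesis by (simp add: vel_eq)
qed

text \<open>The right derivative only sees times from t on, where the partition is locally constant;
  at a shock the slope is that of the merged cluster.\<close>

lemma acceleration_eq:
  assumes "y \<in> support D" "t \<ge> 0"
  shows "vector_derivative (\<lambda>s. u D (\<phi> D y s) s) (at_right t) = slope (clusters D t) y"
proof (rule vector_derivative_within)
  have "\<forall>\<^sub>F s in at_right t. u D (\<phi> D y s) s = line (clusters D t) y s"
    using eventually_clusters_at_right[OF assms(2)] eventually_at_right_less[of t]
    by eventually_elim (use assms velocity_eq in auto)
  moreover have "(line (clusters D t) y has_vector_derivative slope (clusters D t) y) (at_right t)"
    using line_has_derivative by (simp add: has_real_derivative_iff_has_vector_derivative)
  ultimately show "((\<lambda>s. u D (\<phi> D y s) s) has_vector_derivative slope (clusters D t) y) (at_right t)"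
    using velocity_eq[OF assms]
    by (subst has_vector_derivative_cong_ev[where g = "line (clusters D t) y"])
      (auto simp: eventually_at_filter elim: eventually_mono)
qed simp

lemma cluster_of_outside: "y \<notin> support D \<Longrightarrow> cluster_of D y t = {}"
  by (simp add: cluster_of_eq cell_outside[OF partition_clusters])

lemma measurable_velocity: "(\<lambda>y. u D (\<phi> D y t) t) \<in> borel_measurable borel"
  by (rule borel_measurable_constant_off_finite[OF finite_support, of _ "u D (centre D {} t) t"])
    (simp add: \<phi>_def cluster_of_outside)

lemma measurable_acceleration:
  "(\<lambda>y. vector_derivative (\<lambda>s. u D (\<phi> D y s) s) (at_right t)) \<in> borel_measurable borel"
  by (rule borel_measurable_constant_off_finite[OF finite_support,
        of _ "vector_derivative (\<lambda>s. u D (centre D {} s) s) (at_right t)"])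
    (simp add: \<phi>_def cluster_of_outside)

text \<open>Conservation of force: on each block \<open>k\<close> is constant, and
  \<open>\<gamma>0\<close> has the same weighted sum as its mean. This is the tower property behind
  replacing \<Gamma>_0 by \<Gamma>_t.\<close>

lemma sum_slope:
  assumes "partition_on (support D) \<xi>"
  shows "(\<Sum>y\<in>support D. weight D y * (k (cell \<xi> y) * \<gamma>0 D y))
       = (\<Sum>y\<in>support D. weight D y * (k (cell \<xi> y) * slope \<xi> y))"
proof -
  have fin: "\<forall>G\<in>\<xi>. finite G" and disj: "\<forall>G\<in>\<xi>. \<forall>G'\<in>\<xi>. G \<noteq> G' \<longrightarrow> G \<inter> G' = {}" and un: "\<Union>\<xi> = support D"
    using assms finite_subset_support partition_memD[OF assms] by (auto simp: partition_on_def disjoint_def)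
  have cellwise: "(\<Sum>y\<in>support D. weight D y * (k (cell \<xi> y) * h y)) = (\<Sum>G\<in>\<xi>. k G * (\<Sum>y\<in>G. weight D y * h y))" for h
  proof -
    have "(\<Sum>y\<in>support D. weight D y * (k (cell \<xi> y) * h y)) = (\<Sum>G\<in>\<xi>. \<Sum>y\<in>G. weight D y * (k (cell \<xi> y) * h y))"
      using sum.Union_disjoint[OF fin disj] un by simp
    also have "\<dots> = (\<Sum>G\<in>\<xi>. k G * (\<Sum>y\<in>G. weight D y * h y))"
      by (intro sum.cong refl) (simp add: cell_eq[OF assms] sum_distrib_left mult_ac)
    finally show ?thesis .
  qed
  have "(\<Sum>y\<in>G. weight D y * \<gamma>0 D y) = (\<Sum>y\<in>G. weight D y * slope \<xi> y)" if "G \<in> \<xi>" for G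
  proof -
    have "(\<Sum>y\<in>G. weight D y * slope \<xi> y) = (\<Sum>y\<in>G. weight D y * average D (\<gamma>0 D) G)"
      using that by (intro sum.cong) (auto simp: slope_def cell_eq[OF assms])
    also have "\<dots> = (\<Sum>y\<in>G. weight D y * \<gamma>0 D y)"
      using average_mult_total[of G "\<gamma>0 D"] partition_memD[OF assms that]
      by (simp add: sum_distrib_right mult.commute)
    finally show ?thesis by simp
  qed
  then show ?thesis unfolding cellwise by (intro sum.cong) auto
qed

section \<open>Moments of the acceleration, tested against the velocity\<close>

definition moment :: "nat \<Rightarrow> (real \<Rightarrow> real) \<Rightarrow> real set set \<Rightarrow> real \<Rightarrow> real" where
  "moment n g \<xi> t = (\<Sum>y\<in>support D. weight D y * (g (line \<xi> y t) * slope \<xi> y ^ n))"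

abbreviation moment_at :: "nat \<Rightarrow> (real \<Rightarrow> real) \<Rightarrow> real \<Rightarrow> real" where
  "moment_at n g t \<equiv> moment n g (clusters D t) t"

lemma moment_isCont:
  assumes "continuous_on UNIV g"
  shows "isCont (moment n g \<xi>) t"
proof -
  have "isCont g x" for x using assms by (simp add: continuous_on_eq_continuous_at)
  then have "isCont (\<lambda>t. g (line \<xi> y t)) t" for y
    by (rule isCont_o2[OF DERIV_isCont[OF line_has_derivative]])
  then show ?thesis unfolding moment_def[abs_def] by (intro continuous_intros)
qed

lemma moment_tendsto: "continuous_on UNIV g \<Longrightarrow> (moment n g \<xi> \<longlongrightarrow> moment n g \<xi> t) (at t within A)"
  using moment_isCont by (meson isContD tendsto_within_subset subset_UNIV)

text \<open>By the chain rule each time derivative brings out one more factor \<open>slope\<close>;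
  hence the flux of the moment of order n is the moment of order n + 1.\<close>

lemma moment_has_derivative:
  assumes "\<And>x. (g has_real_derivative g' x) (at x)"
  shows "(moment n g \<xi> has_real_derivative moment (Suc n) g' \<xi> t) (at t)"
proof -
  have "((\<lambda>t. g (line \<xi> y t)) has_real_derivative g' (line \<xi> y t) * slope \<xi> y) (at t)" for y
    using DERIV_chain2[OF assms line_has_derivative] .
  then show ?thesis
    unfolding moment_def[abs_def]
    by (auto intro!: DERIV_sum derivative_eq_intros simp: mult_ac)
qed

lemma moment_at_tendsto_right:
  assumes "continuous_on UNIV g" "t \<ge> 0"
  shows "(moment_at n g \<longlongrightarrow> moment_at n g t) (at_right t)"
  using eventually_clusters_at_right[OF assms(2)]
  by (intro tendsto_cong[THEN iffD1, OF _ moment_tendsto[OF assms(1), of n "clusters D t"]])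
    (auto elim: eventually_mono)

definition left_clusters :: "real \<Rightarrow> real set set" where
  "left_clusters t = (SOME \<xi>. (\<forall>\<^sub>F s in at_left t. clusters D s = \<xi>) \<and> (t \<notin> shock_times \<longrightarrow> \<xi> = clusters D t))"

lemma left_clusters:
  assumes "t > 0"
  shows "\<forall>\<^sub>F s in at_left t. clusters D s = left_clusters t"
    and "t \<notin> shock_times \<Longrightarrow> left_clusters t = clusters D t"
  using someI_ex[OF eventually_clusters_at_left[OF assms]] by (auto simp: left_clusters_def)

lemma moment_at_tendsto_left:
  assumes "continuous_on UNIV g" "t > 0"
  shows "(moment_at n g \<longlongrightarrow> moment n g (left_clusters t) t) (at_left t)"
  using left_clusters(1)[OF assms(2)]
  by (intro tendsto_cong[THEN iffD1, OF _ moment_tendsto[OF assms(1), of n "left_clusters t"]])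
    (auto elim: eventually_mono)

lemma eventually_clusters_at:
  assumes "t > 0" "t \<notin> shock_times"
  shows "\<forall>\<^sub>F s in nhds t. clusters D s = clusters D t"
  using left_clusters(1)[OF assms(1)] eventually_clusters_at_right[OF less_imp_le[OF assms(1)]]
  by (simp only: left_clusters(2)[OF assms] eventually_nhds_conv_at eventually_at_split simp_thms)

lemma moment_at_has_derivative:
  assumes "t > 0" "t \<notin> shock_times" "\<And>x. (g has_real_derivative g' x) (at x)"
  shows "(moment_at n g has_real_derivative moment_at (Suc n) g' t) (at t)"
  by (rule DERIV_cong_ev[THEN iffD1, OF refl _ refl moment_has_derivative[OF assms(3)]])
    (use eventually_clusters_at[OF assms(1,2)] in \<open>auto elim: eventually_mono\<close>)

lemma moment_at_isCont:
  assumes "t > 0" "t \<notin> shock_times" "continuous_on UNIV g"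
  shows "isCont (moment_at n g) t"
proof -
  have "\<forall>\<^sub>F s in nhds t. moment_at n g s = moment n g (clusters D t) s"
    using eventually_clusters_at[OF assms(1,2)] by eventually_elim simp
  then show ?thesis using isCont_cong moment_isCont[OF assms(3)] by fastforce
qed

lemma moment_at_bounded:
  assumes "\<And>x. \<bar>g x\<bar> \<le> C"
  shows "\<exists>B. \<forall>t. \<bar>moment_at n g t\<bar> \<le> B"
proof -
  \<comment> \<open>A bound uniform in time: every cell is one of the finitely many subsets of the
    support.\<close>
  define K where "K = (\<Sum>G\<in>Pow (support D). \<bar>average D (\<gamma>0 D) G\<bar>)"
  have "C \<ge> 0" using assms[of 0] by linarith
  have "\<bar>slope (clusters D t) y\<bar> \<le> K" for t y
    unfolding slope_def K_def
    using cell_subset[OF partition_clusters] by (intro member_le_sum) auto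
  then have "\<bar>g x * slope (clusters D t) y ^ n\<bar> \<le> C * K ^ n" for x t y
    unfolding abs_mult power_abs using assms \<open>C \<ge> 0\<close> by (intro mult_mono power_mono) auto
  then have "\<bar>moment_at n g t\<bar> \<le> (\<Sum>y\<in>support D. weight D y * (C * K ^ n))" for t
    unfolding moment_def
    by (intro order_trans[OF sum_abs] sum_mono) (use weight_pos in \<open>auto simp: abs_mult less_imp_le intro!: mult_left_mono\<close>)
  then show ?thesis by blast
qed

lemma eventually_slope_function_of_line:
  "\<forall>\<^sub>F t in at_right 0. \<forall>y\<in>support D. \<forall>z\<in>support D.
     line (clusters D t) y t = line (clusters D t) z t \<longrightarrow> slope (clusters D t) y = slope (clusters D t) z"
proof -
  let ?\<xi> = "clusters D 0"
  have "\<forall>\<^sub>F t in at_right 0. line ?\<xi> y t = line ?\<xi> z t \<longrightarrow> slope ?\<xi> y = slope ?\<xi> z" for y z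
  proof (cases "slope ?\<xi> y = slope ?\<xi> z")
    case False
    \<comment> \<open>The excluded value is the only time at which the two lines cross. It may be 0,
      when the initial velocities agree, but times in \<open>at_right 0\<close> still avoid
      it.\<close>
    show ?thesis
      using eventually_neq_at_right[of "- (line ?\<xi> y 0 - line ?\<xi> z 0) / (slope ?\<xi> y - slope ?\<xi> z)" 0]
      by eventually_elim (use False in \<open>auto simp: line_def slope_def field_simps\<close>)
  qed simp
  then have "\<forall>\<^sub>F t in at_right 0. \<forall>y\<in>support D. \<forall>z\<in>support D.
      line ?\<xi> y t = line ?\<xi> z t \<longrightarrow> slope ?\<xi> y = slope ?\<xi> z"
    by (intro eventually_ball_finite finite_support ballI)
  then show ?thesis
    using eventually_clusters_at_right[OF order_refl]
  proof eventually_elim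
    case (elim t)
    show ?case unfolding elim(2) by (rule elim(1))
  qed
qed

end

section \<open>Fields of measures represented by moments\<close>

text \<open>Treats both balance laws at once: \<mu> is the case \<open>n = 0\<close> and w\<mu> the
  case \<open>n = 1\<close>.\<close>

locale moment_field = sticky_particles +
  fixes m :: "real \<Rightarrow> signed_measure" and n :: nat
  assumes finite_signed: "t > 0 \<Longrightarrow> finite_signed (m t)"
    and sint: "t > 0 \<Longrightarrow> g \<in> borel_measurable borel \<Longrightarrow> (\<And>x. \<bar>g x\<bar> \<le> C) \<Longrightarrow>
      sint (m t) g = moment_at n g t"
begin

lemma sint_continuous:
  assumes "t > 0" "continuous_on UNIV g" "bounded (range g)"
  shows "sint (m t) g = moment_at n g t"
  using assms sint borel_measurable_continuous_onI bounded_range_iff_abs by metis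

lemma sint_tendsto_right:
  assumes "t > 0" "continuous_on UNIV g" "bounded (range g)"
  shows "((\<lambda>s. sint (m s) g) \<longlongrightarrow> sint (m t) g) (at_right t)"
proof -
  have "\<forall>\<^sub>F s in at_right t. moment_at n g s = sint (m s) g"
    using eventually_at_right_less[of t] by eventually_elim (use assms sint_continuous in auto)
  from tendsto_cong[OF this] show ?thesis
    using moment_at_tendsto_right[OF assms(2), of t n] assms sint_continuous by simp
qed

lemma sint_tendsto_left:
  assumes "t > 0" "continuous_on UNIV g" "bounded (range g)"
  shows "((\<lambda>s. sint (m s) g) \<longlongrightarrow> moment n g (left_clusters t) t) (at_left t)"
proof -
  have "\<forall>\<^sub>F s in at_left t. moment_at n g s = sint (m s) g"
    using eventually_at_left_real[OF assms(1)] by eventually_elim (use assms sint_continuous in auto)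
  from tendsto_cong[OF this] show ?thesis
    using moment_at_tendsto_left[OF assms(2,1), of n] by simp
qed

lemma weakly_cadlag: "weakly_cadlag m"
  unfolding weakly_cadlag_def
proof (intro allI impI conjI)
  fix t :: real assume t: "t > 0"
  show "finite_signed (m t)" using finite_signed[OF t] .
  show "weak_limit m (at_right t) (m t)"
    using finite_signed[OF t] sint_tendsto_right[OF t] by (auto simp: weak_limit_def)
  \<comment> \<open>The left limit: point masses at the velocities that the clusters present before
    t have at time t.\<close>
  obtain \<nu> where "finite_signed \<nu>" and \<nu>: "\<And>g. g \<in> borel_measurable borel \<Longrightarrow>
      sint \<nu> g = (\<Sum>y\<in>support D. (weight D y * slope (left_clusters t) y ^ n) * g (line (left_clusters t) y t))"
    using signed_point_measure[OF finite_support,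
        where c = "\<lambda>y. weight D y * slope (left_clusters t) y ^ n" and z = "\<lambda>y. line (left_clusters t) y t"]
    by blast
  have "sint \<nu> g = moment n g (left_clusters t) t" if "continuous_on UNIV g" for g
    using \<nu>[OF borel_measurable_continuous_onI[OF that]] by (simp add: moment_def mult_ac)
  then have "weak_limit m (at_left t) \<nu>"
    using \<open>finite_signed \<nu>\<close> sint_tendsto_left[OF t] by (auto simp: weak_limit_def)
  then show "\<exists>\<nu>. weak_limit m (at_left t) \<nu>" ..
qed

lemma jump_moment:
  assumes "t > 0" "continuous_on UNIV g" "bounded (range g)"
  shows "jump m t g = moment_at n g t - moment n g (left_clusters t) t"
  using jump_eq[OF weakly_cadlag assms sint_tendsto_left[OF assms]] sint_continuous[OF assms] by simp

text \<open>There are finitely many shock times, so some right neighbourhood of 0 contains none and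
  the jumps there are exactly zero.\<close>

lemma jump_tendsto_0:
  assumes "continuous_on UNIV g" "bounded (range g)"
  shows "((\<lambda>t. jump m t g) \<longlongrightarrow> 0) (at_right 0)"
proof (rule tendsto_eventually)
  have "\<forall>\<^sub>F t in at_right 0. \<forall>s\<in>shock_times. t \<noteq> s"
    by (intro eventually_ball_finite finite_shock_times ballI eventually_neq_at_right)
  then show "\<forall>\<^sub>F t in at_right 0. jump m t g = 0"
    using eventually_at_right_less[of 0]
    by eventually_elim (use assms left_clusters(2) in \<open>auto simp: jump_moment\<close>)
qed

text \<open>One balance law before its terms are rewritten through w and a. The jump term compares
  the partitions before and after each shock.\<close>

lemma balance:
  assumes f: "f \<in> C1_0" and "0 < t1" "t1 < t2"
  shows "set_integrable lborel {t1..t2} (moment_at (Suc n) (deriv f))"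
    and "(\<lambda>t. jump m t f) summable_on {t1<..t2}"
    and "moment_at n f t2 - moment_at n f t1 =
      (LBINT t:{t1..t2}. moment_at (Suc n) (deriv f) t) + jump_integral m t1 t2 f"
proof -
  note C1 = C1_0_D[OF f]
  note cont = C_0_continuous[OF C1(1)] and cont' = C_0_continuous[OF C1(3)]
  have bdd: "bounded (range f)" using C_0_bounded[OF C1(1)] bounded_range_iff_abs by metis
  obtain C where C: "\<And>x. \<bar>deriv f x\<bar> \<le> C" using C_0_bounded[OF C1(3)] by blast
  obtain B where B: "\<And>t. \<bar>moment_at (Suc n) (deriv f) t\<bar> \<le> B"
    using moment_at_bounded[of "deriv f" C "Suc n", OF C] by blast
  define L where "L t = moment n f (left_clusters t) t" for t
  have jump: "jump m t f = moment_at n f t - L t" if "t \<in> {t1<..t2}" for t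
    unfolding L_def using jump_moment[OF _ cont bdd] that \<open>0 < t1\<close> by simp
  have right: "(moment_at n f \<longlongrightarrow> moment_at n f t) (at_right t)" if "t1 \<le> t" for t
    using moment_at_tendsto_right[OF cont] that \<open>0 < t1\<close> by simp
  have left: "(moment_at n f \<longlongrightarrow> L t) (at_left t)" if "t1 < t" for t
    unfolding L_def using moment_at_tendsto_left[OF cont] that \<open>0 < t1\<close> by simp
  have no_jump: "L t = moment_at n f t" if "t1 < t" "t \<notin> shock_times" for t
    unfolding L_def using left_clusters(2) that \<open>0 < t1\<close> by simp
  have deriv: "(moment_at n f has_real_derivative moment_at (Suc n) (deriv f) t) (at t)"
    if "t1 < t" "t \<notin> shock_times" for t
    using that \<open>0 < t1\<close> by (intro moment_at_has_derivative C1(2)) auto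
  have isCont: "isCont (moment_at (Suc n) (deriv f)) t" if "t1 < t" "t \<notin> shock_times" for t
    using that \<open>0 < t1\<close> by (intro moment_at_isCont cont') auto
  note ftc = fundamental_theorem_of_calculus_jumps[where L = L,
      OF finite_shock_times \<open>t1 < t2\<close> right left no_jump deriv isCont B]
  show "set_integrable lborel {t1..t2} (moment_at (Suc n) (deriv f))" by (rule ftc(1))
  have "(\<lambda>t. moment_at n f t - L t) summable_on {t1<..t2}" by (rule ftc(2))
  then show "(\<lambda>t. jump m t f) summable_on {t1<..t2}"
    by (rule summable_on_cong[THEN iffD2, rotated]) (rule jump)
  have "moment_at n f t2 - moment_at n f t1 = (LBINT t:{t1..t2}. moment_at (Suc n) (deriv f) t)
      + (\<Sum>\<^sub>\<infinity>t\<in>{t1<..t2}. moment_at n f t - L t)"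
    by (rule ftc(3))
  moreover have "jump_integral m t1 t2 f = (\<Sum>\<^sub>\<infinity>t\<in>{t1<..t2}. moment_at n f t - L t)"
    unfolding jump_integral_def by (rule infsum_cong) (rule jump)
  ultimately show "moment_at n f t2 - moment_at n f t1 =
      (LBINT t:{t1..t2}. moment_at (Suc n) (deriv f) t) + jump_integral m t1 t2 f"
    by simp
qed

end

section \<open>The velocity process and its conditional moments\<close>

locale sticky_process = sticky_particles D + prob_space M for D and M :: "'a measure" +
  fixes X0 :: "'a \<Rightarrow> real"
  assumes X0 [measurable]: "X0 \<in> borel_measurable M" and law: "distr M borel X0 = P0 D"
begin

lemma expectation_X0:
  fixes h :: "real \<Rightarrow> real"
  shows "h \<in> borel_measurable borel \<Longrightarrow> (\<integral>\<omega>. h (X0 \<omega>) \<partial>M) = (\<Sum>y\<in>support D. weight D y * h y)"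
  using integral_distr[OF X0, of h] by (simp add: law integral_P0)

lemma AE_X0_support: "AE \<omega> in M. X0 \<omega> \<in> support D"
proof -
  have "AE y in P0 D. y \<in> support D"
    unfolding P0_def
    by (subst AE_distr_iff)
      (auto simp: measurable_def space_point_measure sets_point_measure support_def finite_imp_closed
        intro!: AE_I2)
  then show ?thesis
    unfolding law[symmetric] by (subst (asm) AE_distr_iff) (auto simp: finite_imp_closed)
qed

text \<open>\<open>X0\<close> almost surely takes finitely many values, so any Borel function of it
  is essentially bounded.\<close>

lemma integrable_X0:
  fixes h :: "real \<Rightarrow> real"
  assumes [measurable]: "h \<in> borel_measurable borel"
  shows "integrable M (\<lambda>\<omega>. h (X0 \<omega>))"
proof (rule integrable_const_bound)
  show "AE \<omega> in M. norm (h (X0 \<omega>)) \<le> (\<Sum>y\<in>support D. \<bar>h y\<bar>)"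
    using AE_X0_support by eventually_elim (auto intro: member_le_sum)
qed simp

lemma V_eq: "V D X0 t = (\<lambda>\<omega>. u D (\<phi> D (X0 \<omega>) t) t)"
  by (simp add: fun_eq_iff V_def X_def)

lemma \<Gamma>_eq: "\<Gamma> D X0 t = (\<lambda>\<omega>. vector_derivative (\<lambda>s. u D (\<phi> D (X0 \<omega>) s) s) (at_right t))"
  by (simp add: fun_eq_iff \<Gamma>_def V_eq)

lemma measurable_V [measurable]: "V D X0 t \<in> borel_measurable M"
  unfolding V_eq by (rule measurable_compose[OF X0 measurable_velocity])

lemma integrable_\<Gamma>_power: "integrable M (\<lambda>\<omega>. \<Gamma> D X0 t \<omega> ^ n)"
  unfolding \<Gamma>_eq
  by (rule integrable_X0) (intro borel_measurable_power measurable_acceleration)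

lemma integrable_\<Gamma>: "integrable M (\<Gamma> D X0 t)"
  using integrable_\<Gamma>_power[of t 1] by simp

lemma expectation_\<Gamma>_power:
  assumes k: "k \<in> borel_measurable borel" and t: "t \<ge> 0"
  shows "(\<integral>\<omega>. k (V D X0 t \<omega>) * \<Gamma> D X0 t \<omega> ^ n \<partial>M) = moment_at n k t"
proof -
  have "(\<lambda>y. k (u D (\<phi> D y t) t) * vector_derivative (\<lambda>s. u D (\<phi> D y s) s) (at_right t) ^ n) \<in> borel_measurable borel"
    by (intro borel_measurable_times borel_measurable_power measurable_acceleration
        measurable_compose[OF measurable_velocity k])
  from expectation_X0[OF this] show ?thesis
    using t by (simp add: V_eq \<Gamma>_eq velocity_eq acceleration_eq moment_def)
qed

text \<open>The velocity is a function of the cluster, so conditioning on it averages the initial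
  acceleration over clusters.\<close>

lemma expectation_\<Gamma>_0:
  assumes k: "k \<in> borel_measurable borel" and t: "t \<ge> 0"
  shows "(\<integral>\<omega>. k (V D X0 t \<omega>) * \<Gamma> D X0 0 \<omega> \<partial>M) = moment_at 1 k t"
proof -
  have "(\<lambda>y. k (u D (\<phi> D y t) t) * vector_derivative (\<lambda>s. u D (\<phi> D y s) s) (at_right 0)) \<in> borel_measurable borel"
    by (intro borel_measurable_times measurable_acceleration measurable_compose[OF measurable_velocity k])
  from expectation_X0[OF this]
  have "(\<integral>\<omega>. k (V D X0 t \<omega>) * \<Gamma> D X0 0 \<omega> \<partial>M)
      = (\<Sum>y\<in>support D. weight D y * (k (line (clusters D t) y t) * slope (clusters D 0) y))"
    using t by (simp add: V_eq \<Gamma>_eq velocity_eq acceleration_eq)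
  also have "\<dots> = (\<Sum>y\<in>support D. weight D y * (k (line (clusters D t) y t) * \<gamma>0 D y))"
  proof (intro sum.cong refl)
    fix y assume y: "y \<in> support D"
    \<comment> \<open>At time 0 clusters are singletons, so the slope is the particle's own
      acceleration.\<close>
    have "cell (clusters D 0) y = {y}"
      using y by (intro cell_eq[OF partition_clusters]) (auto simp: clusters_0)
    then have "slope (clusters D 0) y = \<gamma>0 D y"
      using weight_pos[OF y] by (simp add: slope_def average_def)
    then show "weight D y * (k (line (clusters D t) y t) * slope (clusters D 0) y)
        = weight D y * (k (line (clusters D t) y t) * \<gamma>0 D y)" by simp
  qed
  \<comment> \<open>The factor \<open>k (line ...)\<close> depends on \<open>y\<close> only through
    its cell, as \<open>sum_slope\<close> requires.\<close>
  also have "\<dots> = (\<Sum>y\<in>support D. weight D y * (k (line (clusters D t) y t) * slope (clusters D t) y))"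
    unfolding line_def by (rule sum_slope[OF partition_clusters])
  finally show ?thesis by (simp add: moment_def)
qed

lemma integral_law: "k \<in> borel_measurable borel \<Longrightarrow> t \<ge> 0 \<Longrightarrow> (\<integral>x. k x \<partial>distr M borel (V D X0 t)) = moment_at 0 k t"
  using expectation_\<Gamma>_power[of k t 0] by (simp add: integral_distr)

lemma integral_law_cond_exp:
  assumes w: "is_cond_exp_at M (\<Gamma> D X0 0) (V D X0 t) w"
    and k [measurable]: "k \<in> borel_measurable borel" and "\<And>x. \<bar>k x\<bar> \<le> C" and "t \<ge> 0"
  shows "(\<integral>x. k x * w x \<partial>distr M borel (V D X0 t)) = moment_at 1 k t"
proof -
  have [measurable]: "w \<in> borel_measurable borel" using w by (simp add: is_cond_exp_at_def)
  show ?thesis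
    using is_cond_exp_at_integral(2)[OF w integrable_\<Gamma> measurable_V assms(2,3)]
      expectation_\<Gamma>_0[OF k \<open>t \<ge> 0\<close>]
    by (simp add: integral_distr)
qed

lemma integrable_law_cond_exp:
  assumes w: "is_cond_exp_at M (\<Gamma> D X0 0) (V D X0 t) w"
  shows "integrable (distr M borel (V D X0 t)) w"
proof -
  have [measurable]: "w \<in> borel_measurable borel" using w by (simp add: is_cond_exp_at_def)
  show ?thesis
    using is_cond_exp_at_integral(1)[OF w integrable_\<Gamma> measurable_V, of "\<lambda>_. 1" 1]
    by (simp add: integrable_distr_eq)
qed

text \<open>The variance contains its own version \<open>g\<close> of E[\<Gamma>_t | V_t], while
  \<open>w\<close> is a version of E[\<Gamma>_0 | V_t]. They agree almost surely along V_t, so the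
  squares cancel and only the second conditional moment \<open>h\<close> remains.\<close>

lemma integral_law_cond_var:
  assumes w: "is_cond_exp_at M (\<Gamma> D X0 0) (V D X0 t) w"
    and a: "is_cond_var_at M (\<Gamma> D X0 t) (V D X0 t) a"
    and k [measurable]: "k \<in> borel_measurable borel" and bound: "\<And>x. \<bar>k x\<bar> \<le> C" and t: "t \<ge> 0"
  shows "(\<integral>x. k x * ((w x)\<^sup>2 + a x) \<partial>distr M borel (V D X0 t)) = moment_at 2 k t"
proof -
  obtain g h where g: "is_cond_exp_at M (\<Gamma> D X0 t) (V D X0 t) g"
    and h: "is_cond_exp_at M (\<lambda>\<omega>. (\<Gamma> D X0 t \<omega>)\<^sup>2) (V D X0 t) h"
    and a_eq: "a = (\<lambda>x. h x - (g x)\<^sup>2)"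
    using a by (auto simp: is_cond_var_at_def)
  have [measurable]: "w \<in> borel_measurable borel" "g \<in> borel_measurable borel" "h \<in> borel_measurable borel"
    using w g h by (auto simp: is_cond_exp_at_def)
  have ae: "AE \<omega> in M. w (V D X0 t \<omega>) = g (V D X0 t \<omega>)"
    using expectation_\<Gamma>_0[OF _ t] expectation_\<Gamma>_power[OF _ t, of _ 1]
    by (intro is_cond_exp_at_unique[OF w g] integrable_\<Gamma> measurable_V) simp
  have "(\<integral>x. k x * ((w x)\<^sup>2 + a x) \<partial>distr M borel (V D X0 t))
      = (\<integral>\<omega>. k (V D X0 t \<omega>) * ((w (V D X0 t \<omega>))\<^sup>2 + (h (V D X0 t \<omega>) - (g (V D X0 t \<omega>))\<^sup>2)) \<partial>M)"
    unfolding a_eq by (subst integral_distr) auto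
  also have "\<dots> = (\<integral>\<omega>. k (V D X0 t \<omega>) * h (V D X0 t \<omega>) \<partial>M)"
    using ae by (intro integral_cong_AE) (auto elim: eventually_mono)
  also have "\<dots> = moment_at 2 k t"
    using is_cond_exp_at_integral(2)[OF h integrable_\<Gamma>_power measurable_V k bound]
      expectation_\<Gamma>_power[OF k t] by simp
  finally show ?thesis .
qed

text \<open>Two distinct lines meet at most once, so shortly after time 0 particles with equal velocities
  have equal accelerations: the acceleration is then a function of the velocity.\<close>

lemma eventually_cond_var_0:
  "\<forall>\<^sub>F t in at_right 0. \<forall>a. is_cond_var_at M (\<Gamma> D X0 t) (V D X0 t) a \<longrightarrow>
     (\<forall>g. (\<integral>x. g x * a x \<partial>distr M borel (V D X0 t)) = 0)"
  using eventually_slope_function_of_line eventually_at_right_less[of 0]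
proof eventually_elim
  case (elim t)
  let ?line = "\<lambda>y. line (clusters D t) y t" and ?slope = "slope (clusters D t)"
  \<comment> \<open>The acceleration as a function of the velocity. The particle picked by
    \<open>inv_into\<close> is arbitrary among those with velocity \<open>v\<close>; they all have
    the same slope by \<open>elim(1)\<close>.\<close>
  define \<kappa> where "\<kappa> v = (if v \<in> ?line ` support D then ?slope (inv_into (support D) ?line v) else 0)" for v
  have \<kappa>_meas [measurable]: "\<kappa> \<in> borel_measurable borel"
    by (rule borel_measurable_constant_off_finite[of "?line ` support D" _ 0]) (auto simp: \<kappa>_def)
  have \<kappa>_line: "\<kappa> (?line y) = ?slope y" if "y \<in> support D" for y
  proof -
    have *: "?line y \<in> ?line ` support D" using that by simp
    have "?slope (inv_into (support D) ?line (?line y)) = ?slope y"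
      by (rule elim(1)[rule_format, OF inv_into_into[OF *] that f_inv_into_f[OF *]])
    then show ?thesis unfolding \<kappa>_def if_P[OF *] .
  qed
  have \<Gamma>: "AE \<omega> in M. \<Gamma> D X0 t \<omega> = \<kappa> (V D X0 t \<omega>)"
    using AE_X0_support by eventually_elim (use elim(2) in \<open>simp add: V_eq \<Gamma>_eq velocity_eq acceleration_eq \<kappa>_line\<close>)
  show ?case
  proof (intro allI impI)
    fix a b assume a: "is_cond_var_at M (\<Gamma> D X0 t) (V D X0 t) a"
    obtain g h where g: "is_cond_exp_at M (\<Gamma> D X0 t) (V D X0 t) g"
      and h: "is_cond_exp_at M (\<lambda>\<omega>. (\<Gamma> D X0 t \<omega>)\<^sup>2) (V D X0 t) h"
      and a_eq: "a = (\<lambda>x. h x - (g x)\<^sup>2)"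
      using a by (auto simp: is_cond_var_at_def)
    have [measurable]: "g \<in> borel_measurable borel" "h \<in> borel_measurable borel"
      using g h by (auto simp: is_cond_exp_at_def)
    have "AE \<omega> in M. g (V D X0 t \<omega>) = \<kappa> (V D X0 t \<omega>)"
      by (rule is_cond_exp_at_of_function[OF g integrable_\<Gamma> measurable_V \<kappa>_meas \<Gamma>])
    moreover have "AE \<omega> in M. h (V D X0 t \<omega>) = (\<kappa> (V D X0 t \<omega>))\<^sup>2"
      using \<Gamma> by (intro is_cond_exp_at_of_function[OF h integrable_\<Gamma>_power measurable_V])
        (auto elim: eventually_mono)
    \<comment> \<open>The first and second conditional moments are \<kappa> and its square, so their
      variance is zero.\<close>
    ultimately have "AE \<omega> in M. a (V D X0 t \<omega>) = 0"
      by eventually_elim (simp add: a_eq)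
    then have "AE x in distr M borel (V D X0 t). a x = 0"
      by (subst AE_distr_iff) (auto simp: a_eq)
    then show "(\<integral>x. b x * a x \<partial>distr M borel (V D X0 t)) = 0"
      by (intro integral_eq_zero_AE) (auto elim: eventually_mono)
  qed
qed

end

theorem proposition5p5:
  fixes D :: particles
    and M :: "'a measure" and X0 :: "'a \<Rightarrow> real"
    and w a :: "real \<Rightarrow> real \<Rightarrow> real" and w0 :: "real \<Rightarrow> real"
    and \<mu> :: "real \<Rightarrow> real measure" and \<mu>0 :: "real measure"
    and \<mu>s w\<mu>s :: "real \<Rightarrow> signed_measure"
  assumes "particle_system D"
    and "(\<Sum>j\<in>{1..num D}. mass D j) = 1"
    and "antimono_on (support D) (\<gamma>0 D)"
    and "prob_space M" and "X0 \<in> borel_measurable M" and "distr M borel X0 = P0 D"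
    and "\<And>t. \<mu> t = distr M borel (V D X0 t)" and "\<mu>0 = distr M borel (V D X0 0)"
    and "\<And>t. t > 0 \<Longrightarrow> is_cond_exp_at M (\<Gamma> D X0 0) (V D X0 t) (\<lambda>x. w x t)"
    and "is_cond_exp_at M (\<Gamma> D X0 0) (V D X0 0) w0"
    and "\<And>t. t > 0 \<Longrightarrow> is_cond_var_at M (\<Gamma> D X0 t) (V D X0 t) (\<lambda>x. a x t)"
    and "\<And>t. \<mu>s t = signed (\<mu> t)"
    and "\<And>t. w\<mu>s t = signed_density (\<lambda>x. w x t) (\<mu> t)"
  shows "weakly_cadlag \<mu>s \<and> weakly_cadlag w\<mu>s \<and>
    (\<forall>f\<in>C1_0. \<forall>t1 t2. 0 < t1 \<and> t1 < t2 \<longrightarrow>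
       set_integrable lborel {t1..t2} (\<lambda>t. \<integral>x. deriv f x * w x t \<partial>\<mu> t) \<and>
       (\<lambda>t. jump \<mu>s t f) summable_on {t1<..t2} \<and>
       (\<integral>x. f x \<partial>\<mu> t2) - (\<integral>x. f x \<partial>\<mu> t1) =
         (LBINT t:{t1..t2}. \<integral>x. deriv f x * w x t \<partial>\<mu> t) + jump_integral \<mu>s t1 t2 f) \<and>
    (\<forall>f\<in>C1_0. \<forall>t1 t2. 0 < t1 \<and> t1 < t2 \<longrightarrow>
       set_integrable lborel {t1..t2} (\<lambda>t. \<integral>x. deriv f x * ((w x t)\<^sup>2 + a x t) \<partial>\<mu> t) \<and>
       (\<lambda>t. jump w\<mu>s t f) summable_on {t1<..t2} \<and>
       (\<integral>x. f x * w x t2 \<partial>\<mu> t2) - (\<integral>x. f x * w x t1 \<partial>\<mu> t1) =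
         (LBINT t:{t1..t2}. \<integral>x. deriv f x * ((w x t)\<^sup>2 + a x t) \<partial>\<mu> t) + jump_integral w\<mu>s t1 t2 f) \<and>
    (\<forall>g\<in>C_0.
       ((\<lambda>t. \<integral>x. g x \<partial>\<mu> t) \<longlongrightarrow> (\<integral>x. g x \<partial>\<mu>0)) (at_right 0) \<and>
       ((\<lambda>t. \<integral>x. g x * w x t \<partial>\<mu> t) \<longlongrightarrow> (\<integral>x. g x * w0 x \<partial>\<mu>0)) (at_right 0) \<and>
       ((\<lambda>t. \<integral>x. g x * a x t \<partial>\<mu> t) \<longlongrightarrow> 0) (at_right 0) \<and>
       ((\<lambda>t. jump \<mu>s t g) \<longlongrightarrow> 0) (at_right 0) \<and>
       ((\<lambda>t. jump w\<mu>s t g) \<longlongrightarrow> 0) (at_right 0))"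
proof -
  interpret sticky_process D M X0
    using assms(1,4-6) by (simp add: sticky_process_def sticky_process_axioms_def sticky_particles_def)
  have \<mu>: "\<mu> t = distr M borel (V D X0 t)" for t by fact
  have \<mu>0: "\<mu>0 = distr M borel (V D X0 0)" by fact
  have w: "is_cond_exp_at M (\<Gamma> D X0 0) (V D X0 t) (\<lambda>x. w x t)" if "t > 0" for t using assms(9) that .
  have w0: "is_cond_exp_at M (\<Gamma> D X0 0) (V D X0 0) w0" by fact
  have a: "is_cond_var_at M (\<Gamma> D X0 t) (V D X0 t) (\<lambda>x. a x t)" if "t > 0" for t using assms(11) that .
  have \<mu>s: "\<mu>s t = signed (\<mu> t)" and w\<mu>s: "w\<mu>s t = signed_density (\<lambda>x. w x t) (\<mu> t)" for t by fact+
  have int_\<mu>: "(\<integral>x. k x \<partial>\<mu> t) = moment_at 0 k t" if "k \<in> borel_measurable borel" "t \<ge> 0" for k t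
    unfolding \<mu> using that by (rule integral_law)
  have int_w\<mu>: "(\<integral>x. k x * w x t \<partial>\<mu> t) = moment_at 1 k t"
    if "k \<in> borel_measurable borel" "\<And>x. \<bar>k x\<bar> \<le> C" "t > 0" for k C t
    unfolding \<mu> using integral_law_cond_exp[OF w[OF that(3)] that(1,2)] that(3) by simp
  have int_wa\<mu>: "(\<integral>x. k x * ((w x t)\<^sup>2 + a x t) \<partial>\<mu> t) = moment_at 2 k t"
    if "k \<in> borel_measurable borel" "\<And>x. \<bar>k x\<bar> \<le> C" "t > 0" for k C t
    unfolding \<mu> using integral_law_cond_var[OF w[OF that(3)] a[OF that(3)] that(1,2)] that(3) by simp
  interpret \<mu>: moment_field D \<mu>s 0
  proof unfold_locales
    fix t :: real assume "t > 0"
    show "finite_signed (\<mu>s t)"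
      unfolding \<mu>s \<mu> by (intro finite_signed_signed finite_measure_distr measurable_V) simp
    show "sint (\<mu>s t) g = moment_at 0 g t" if "g \<in> borel_measurable borel" for g
      unfolding \<mu>s sint_signed using int_\<mu> that \<open>t > 0\<close> by simp
  qed
  interpret w\<mu>: moment_field D w\<mu>s 1
  proof unfold_locales
    fix t :: real assume t: "t > 0"
    have int: "integrable (\<mu> t) (\<lambda>x. w x t)"
      unfolding \<mu> by (rule integrable_law_cond_exp[OF w[OF t]])
    have sets: "sets (\<mu> t) = sets borel" by (simp add: \<mu>)
    show "finite_signed (w\<mu>s t)"
      unfolding w\<mu>s by (rule finite_signed_density[OF int sets])
    show "sint (w\<mu>s t) g = moment_at 1 g t"
      if "g \<in> borel_measurable borel" "\<And>x. \<bar>g x\<bar> \<le> C" for g C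
      unfolding w\<mu>s sint_signed_density[OF int sets that] by (rule int_w\<mu>[OF that t])
  qed
  have pos: "\<forall>\<^sub>F t in at_right (0::real). 0 < t" by (rule eventually_at_right_less)
  show ?thesis
  proof (intro conjI ballI allI impI)
    show "weakly_cadlag \<mu>s" "weakly_cadlag w\<mu>s"
      by (rule \<mu>.weakly_cadlag w\<mu>.weakly_cadlag)+
  next
    fix f and t1 t2 :: real assume f: "f \<in> C1_0" and t: "0 < t1 \<and> t1 < t2"
    note f_meas = C_0_measurable[OF C1_0_D(1)[OF f]] and f'_meas = C_0_measurable[OF C1_0_D(3)[OF f]]
    obtain C where C: "\<And>x. \<bar>f x\<bar> \<le> C" using C_0_bounded[OF C1_0_D(1)[OF f]] by blast
    obtain C' where C': "\<And>x. \<bar>deriv f x\<bar> \<le> C'" using C_0_bounded[OF C1_0_D(3)[OF f]] by blast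
    \<comment> \<open>\<open>w\<close> and \<open>a\<close> are constrained only at positive times;
      the whole interval \<open>{t1..t2}\<close> lies there, so the fluxes may be replaced by
      moments on it.\<close>
    have flux: "(\<integral>x. deriv f x * w x t \<partial>\<mu> t) = moment_at (Suc 0) (deriv f) t"
      "(\<integral>x. deriv f x * ((w x t)\<^sup>2 + a x t) \<partial>\<mu> t) = moment_at (Suc 1) (deriv f) t"
      if "t \<in> {t1..t2}" for t
      using int_w\<mu>[OF f'_meas C'] int_wa\<mu>[OF f'_meas C'] that t by (simp_all add: numeral_2_eq_2)
    note \<mu>_balance = \<mu>.balance[OF f, of t1 t2] and w\<mu>_balance = w\<mu>.balance[OF f, of t1 t2]
    show "set_integrable lborel {t1..t2} (\<lambda>t. \<integral>x. deriv f x * w x t \<partial>\<mu> t)"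
      using \<mu>_balance(1) t flux(1) by (subst set_integrable_cong[OF refl refl]) auto
    show "set_integrable lborel {t1..t2} (\<lambda>t. \<integral>x. deriv f x * ((w x t)\<^sup>2 + a x t) \<partial>\<mu> t)"
      using w\<mu>_balance(1) t flux(2) by (subst set_integrable_cong[OF refl refl]) auto
    show "(\<lambda>t. jump \<mu>s t f) summable_on {t1<..t2}" "(\<lambda>t. jump w\<mu>s t f) summable_on {t1<..t2}"
      using \<mu>_balance(2) w\<mu>_balance(2) t by auto
    have "(LBINT t:{t1..t2}. \<integral>x. deriv f x * w x t \<partial>\<mu> t) = (LBINT t:{t1..t2}. moment_at (Suc 0) (deriv f) t)"
      "(LBINT t:{t1..t2}. \<integral>x. deriv f x * ((w x t)\<^sup>2 + a x t) \<partial>\<mu> t) = (LBINT t:{t1..t2}. moment_at (Suc 1) (deriv f) t)"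
      using flux by (auto intro!: set_lebesgue_integral_cong)
    then show "(\<integral>x. f x \<partial>\<mu> t2) - (\<integral>x. f x \<partial>\<mu> t1) =
         (LBINT t:{t1..t2}. \<integral>x. deriv f x * w x t \<partial>\<mu> t) + jump_integral \<mu>s t1 t2 f"
      "(\<integral>x. f x * w x t2 \<partial>\<mu> t2) - (\<integral>x. f x * w x t1 \<partial>\<mu> t1) =
         (LBINT t:{t1..t2}. \<integral>x. deriv f x * ((w x t)\<^sup>2 + a x t) \<partial>\<mu> t) + jump_integral w\<mu>s t1 t2 f"
      using \<mu>_balance(3) w\<mu>_balance(3) t int_\<mu>[OF f_meas] int_w\<mu>[OF f_meas C] by simp_all
  next
    fix g assume g: "g \<in> C_0"
    note meas = C_0_measurable[OF g] and cont = C_0_continuous[OF g]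
    obtain C where C: "\<And>x. \<bar>g x\<bar> \<le> C" using C_0_bounded[OF g] by blast
    then have bdd: "bounded (range g)" using bounded_range_iff_abs by blast
    have "\<forall>\<^sub>F t in at_right 0. moment_at 0 g t = (\<integral>x. g x \<partial>\<mu> t)"
      using pos by eventually_elim (simp add: int_\<mu>[OF meas])
    from tendsto_cong[OF this] show "((\<lambda>t. \<integral>x. g x \<partial>\<mu> t) \<longlongrightarrow> (\<integral>x. g x \<partial>\<mu>0)) (at_right 0)"
      using moment_at_tendsto_right[OF cont, of 0 0] integral_law[OF meas, of 0] by (simp add: \<mu>0)
    have "\<forall>\<^sub>F t in at_right 0. moment_at 1 g t = (\<integral>x. g x * w x t \<partial>\<mu> t)"
      using pos by eventually_elim (simp add: int_w\<mu>[OF meas C])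
    from tendsto_cong[OF this] show "((\<lambda>t. \<integral>x. g x * w x t \<partial>\<mu> t) \<longlongrightarrow> (\<integral>x. g x * w0 x \<partial>\<mu>0)) (at_right 0)"
      using moment_at_tendsto_right[OF cont, of 0 1] integral_law_cond_exp[OF w0 meas C] by (simp add: \<mu>0)
    \<comment> \<open>The neighbourhood of 0 in \<open>eventually_cond_var_0\<close> is the same for
      all versions of the variance, so it serves although \<open>a\<close> is chosen anew at each
      time.\<close>
    have "\<forall>\<^sub>F t in at_right 0. (\<integral>x. g x * a x t \<partial>\<mu> t) = 0"
      using eventually_cond_var_0 pos
    proof eventually_elim
      case (elim t)
      show ?case unfolding \<mu> using elim(1)[rule_format, OF a[OF elim(2)]] .
    qed
    then show "((\<lambda>t. \<integral>x. g x * a x t \<partial>\<mu> t) \<longlongrightarrow> 0) (at_right 0)" by (rule tendsto_eventually)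
    show "((\<lambda>t. jump \<mu>s t g) \<longlongrightarrow> 0) (at_right 0)" "((\<lambda>t. jump w\<mu>s t g) \<longlongrightarrow> 0) (at_right 0)"
      by (rule \<mu>.jump_tendsto_0[OF cont bdd] w\<mu>.jump_tendsto_0[OF cont bdd])+
  qed
qed

end
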